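(* For every $\epsilon > 0$ there is a constant $C_\epsilon > 0$ such that the following holds. Let $p > 3$ be a prime, let $a$ be an integer with $\gcd(a, p) = 1$, let $c$ be any integer, and let $H$ be a positive integer with $H \ge C_\epsilon\, p^{1/6 + \epsilon}$. Let $C_{a,c} := \{(x, y) \in (\mathbb{Z}/p\mathbb{Z})^2 : y \equiv a x^3 + c x \pmod p\}$, and for integers $X, Y$ let $B(X, Y; H) := \{(x, y) \in (\mathbb{Z}/p\mathbb{Z})^2 : x \equiv X + i \pmod p,\ y \equiv Y + j \pmod p \text{ for some integers } 1 \le i, j \le H\}$. Then there exist integers $0 \le X, Y \le p - 1$ such that $|C_{a,c} \cap B(X, Y; H)| \ge 2$.
   Context: The box $B(X,Y;H)$ is a square of side length $H$ taken with residues modulo $p$ (wrapping around), and $|S|$ denotes the number of elements of a set $S$. *)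

theory Defs
  imports "HOL-Analysis.Analysis" "HOL-Number_Theory.Cong"
begin

text \<open>Points of (Z/pZ)^2 are represented by their canonical residues in {0..p-1}.\<close>

definition curve_pts :: "int \<Rightarrow> int \<Rightarrow> int \<Rightarrow> (int \<times> int) set" where
  "curve_pts p a c = {(x, y). x \<in> {0..p-1} \<and> y \<in> {0..p-1} \<and> [y = a * x^3 + c * x] (mod p)}"

definition box_pts :: "int \<Rightarrow> int \<Rightarrow> int \<Rightarrow> int \<Rightarrow> (int \<times> int) set" where
  "box_pts p X Y H = {(x, y). x \<in> {0..p-1} \<and> y \<in> {0..p-1} \<and>
     (\<exists>i j. 1 \<le> i \<and> i \<le> H \<and> 1 \<le> j \<and> j \<le> H \<and> [x = X + i] (mod p) \<and> [y = Y + j] (mod p))}"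

end

theory Submission
  imports Defs "HOL-Number_Theory.Number_Theory" "HOL-Real_Asymp.Real_Asymp"
begin

text \<open>
  Suppose that no box of side \<open>H\<close> contains two points, and put \<open>4 A = a\<close> and
  \<open>F(h) = A h\<^sup>3 + c h\<close> modulo \<open>p\<close>. The points with abscissae \<open>x\<close> and \<open>x + h\<close> have ordinates
  differing by \<open>k\<close> iff \<open>x\<close> solves a quadratic equation of discriminant \<open>12 a h (k - F(h))\<close>. So for
  \<open>1 \<le> h < H\<close> the Legendre symbol of \<open>k - F(h)\<close> is a nonzero constant on \<open>0 \<le> k < H\<close>. Consequently,
  if \<open>v x = k - F(h)\<close> with \<open>h, k \<le> H/2\<close> and \<open>v\<close> prime, the symbol is constant on
  \<open>x + 1, \<dots>, x + u\<close> as long as \<open>u v \<le> H/2\<close>.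

  By Weil's bound (proved by Stepanov's method) at most \<open>O(p\<^sup>1\<^sup>/\<^sup>2 log p)\<close> residues \<open>x\<close> start such a
  run of length \<open>log p\<close>. On the other hand the residues \<open>(k - F(h)) / v\<close> are numerous. The values
  \<open>k - F(h)\<close> seldom coincide, because a coincidence is a point on a fixed line modulo \<open>p\<close> with
  coordinates so small that it lies on a rational line, and then a divisor bound applies. Two
  quotients \<open>(k - F(h)) / v = (k' - F(h')) / v'\<close> with \<open>v \<noteq> v'\<close> are rare as well: if several pairs
  \<open>(v, v')\<close> occur for the same \<open>(h, h')\<close>, then \<open>F(h)\<close> and \<open>F(h')\<close> are fractions with small numerator
  and denominator modulo \<open>p\<close>, the coincidence is an identity of integers, and each of \<open>v\<close>, \<open>v'\<close>
  divides one of the denominators unless it divides a certain small nonzero integer attached to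
  \<open>(h, k)\<close> or \<open>(h', k')\<close>. This yields more than \<open>p\<^sup>1\<^sup>/\<^sup>2\<^sup>+\<^sup>\<epsilon>\<close> residues \<open>x\<close>, a contradiction.
\<close>

hide_const (open) UnivPoly.coeff UnivPoly.monom Module.smult

subsection \<open>Polynomials modulo a prime element\<close>

definition pcong :: "'a::idom poly \<Rightarrow> 'a poly \<Rightarrow> 'a \<Rightarrow> bool"  ("(1[_ = _] '(pmod _'))")
  where "[f = g] (pmod c) \<longleftrightarrow> [:c:] dvd f - g"

lemma pcong_0_iff: "[f = 0] (pmod c) \<longleftrightarrow> [:c:] dvd f"
  by (simp add: pcong_def)

lemma pcong_refl [simp]: "[f = f] (pmod c)"
  by (simp add: pcong_def)

lemma pcong_sym: "[f = g] (pmod c) \<Longrightarrow> [g = f] (pmod c)"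
  unfolding pcong_def by (metis dvd_minus_iff minus_diff_eq)

lemma pcong_trans [trans]: "[f = g] (pmod c) \<Longrightarrow> [g = h] (pmod c) \<Longrightarrow> [f = h] (pmod c)"
  unfolding pcong_def by (drule (1) dvd_add) simp

lemma pcong_add: "[f = g] (pmod c) \<Longrightarrow> [f' = g'] (pmod c) \<Longrightarrow> [f + f' = g + g'] (pmod c)"
  unfolding pcong_def by (drule (1) dvd_add) (simp add: add_diff_add)

lemma pcong_diff: "[f = g] (pmod c) \<Longrightarrow> [f' = g'] (pmod c) \<Longrightarrow> [f - f' = g - g'] (pmod c)"
  unfolding pcong_def by (drule (1) dvd_diff) (simp add: algebra_simps)

lemma pcong_mult:
  assumes "[f = g] (pmod c)" "[f' = g'] (pmod c)"
  shows "[f * f' = g * g'] (pmod c)"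
proof -
  have "f * f' - g * g' = (f - g) * f' + g * (f' - g')" by (simp add: algebra_simps)
  thus ?thesis using assms by (simp add: pcong_def)
qed

lemma pcong_power: "[f = g] (pmod c) \<Longrightarrow> [f ^ n = g ^ n] (pmod c)"
  by (induction n) (simp_all add: pcong_mult)

lemma pcong_iff_coeff: "[f = g] (pmod c) \<longleftrightarrow> (\<forall>n. c dvd coeff f n - coeff g n)"
  by (simp add: pcong_def const_poly_dvd_iff)

lemma pcong_imp_dvd_poly_diff: "[f = g] (pmod c) \<Longrightarrow> c dvd poly f a - poly g a"
  by (auto simp: pcong_def simp flip: poly_diff elim: dvdE)

lemma pcong_mult_0_iff:
  assumes "prime_elem c"
  shows "[f * g = 0] (pmod c) \<longleftrightarrow> [f = 0] (pmod c) \<or> [g = 0] (pmod c)"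
  unfolding pcong_0_iff by (rule prime_elem_dvd_mult_iff[OF lift_prime_elem_poly[OF assms]])

lemma pcong_power_0D:
  assumes "prime_elem c" "[f ^ n = 0] (pmod c)"
  shows "[f = 0] (pmod c)"
  using assms(2) unfolding pcong_0_iff
  by (rule prime_elem_dvd_power[OF lift_prime_elem_poly[OF assms(1)]])

lemma pcong_mult_cancel_left:
  assumes "prime_elem c" "\<not> [h = 0] (pmod c)" "[h * f = h * g] (pmod c)"
  shows "[f = g] (pmod c)"
proof -
  have "[h * (f - g) = 0] (pmod c)" using assms(3) by (simp add: pcong_def right_diff_distrib)
  thus ?thesis using assms(2) unfolding pcong_mult_0_iff[OF assms(1)] by (simp add: pcong_def)
qed

lemma not_pcong_0_linear:
  assumes "\<not> c dvd 1"
  shows "\<not> [[:- a, 1:] = 0] (pmod c)"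
proof
  assume "[[:- a, 1:] = 0] (pmod c)"
  hence "c dvd coeff [:- a, 1:] 1" by (simp only: pcong_0_iff const_poly_dvd_iff)
  thus False using assms by simp
qed

lemma pcong_linear_mult_synthetic_div:
  assumes "c dvd poly f a"
  shows "[f = [:- a, 1:] * synthetic_div f a] (pmod c)"
proof -
  have "f - [:- a, 1:] * synthetic_div f a = [:poly f a:]"
    using synthetic_div_correct'[of a f] by (simp add: algebra_simps)
  thus ?thesis using assms by (simp add: pcong_def)
qed

definition pdvd :: "'a::idom \<Rightarrow> 'a poly \<Rightarrow> 'a poly \<Rightarrow> bool"
  where "pdvd c g f \<longleftrightarrow> (\<exists>q. [f = g * q] (pmod c))"

lemma pdvd_linear_power_cancel:
  assumes c: "prime_elem c" and g: "\<not> c dvd poly g b"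
    and "pdvd c ([:- b, 1:] ^ l) (g * f)"
  shows "pdvd c ([:- b, 1:] ^ l) f"
  using assms(3)
proof (induction l arbitrary: f)
  case 0
  show ?case by (auto simp: pdvd_def intro: exI[of _ f])
next
  case (Suc l)
  define X where "X = [:- b, 1:]"
  have X: "\<not> [X = 0] (pmod c)"
    unfolding X_def by (rule not_pcong_0_linear[OF prime_elem_not_unit[OF c]])
  obtain q where q: "[g * f = X ^ Suc l * q] (pmod c)"
    using Suc.prems by (auto simp: pdvd_def X_def)
  have "c dvd poly (g * f) b - poly (X ^ Suc l * q) b"
    using q by (rule pcong_imp_dvd_poly_diff)
  hence "c dvd poly f b"
    using g c by (simp add: X_def prime_elem_dvd_mult_iff)
  then obtain f1 where f1: "[f = X * f1] (pmod c)"
    using pcong_linear_mult_synthetic_div unfolding X_def by blast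
  have "[X * (g * f1) = g * f] (pmod c)"
    using pcong_mult[OF pcong_refl[of g] pcong_sym[OF f1]] by (simp only: mult_ac)
  also note q
  also have "X ^ Suc l * q = X * (X ^ l * q)" by simp
  finally have "[g * f1 = X ^ l * q] (pmod c)"
    by (rule pcong_mult_cancel_left[OF c X])
  then obtain q' where q': "[f1 = X ^ l * q'] (pmod c)"
    using Suc.IH[of f1] by (auto simp: pdvd_def X_def)
  have "[X * f1 = X * (X ^ l * q')] (pmod c)" using q' by (intro pcong_mult) auto
  with f1 have "[f = X ^ Suc l * q'] (pmod c)"
    unfolding power_Suc mult.assoc by (rule pcong_trans)
  thus ?case unfolding pdvd_def X_def by blast
qed

lemma not_dvd_poly_prod_linear_power:
  fixes c :: "'a::idom"
  assumes "prime_elem c" "finite A" "\<And>a. a \<in> A \<Longrightarrow> \<not> c dvd b - a"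
  shows "\<not> c dvd poly (\<Prod>a\<in>A. [:- a, 1:] ^ l a) b"
  using assms(2,3)
proof (induction A rule: finite_induct)
  case (insert a A)
  have "poly [:- a, 1:] b = b - a" by simp
  with insert show ?case
    using assms(1) prime_elem_dvd_power[of c "b - a" "l a"]
    by (auto simp: prime_elem_dvd_mult_iff poly_power simp del: poly_pCons)
qed (use assms(1) in \<open>auto simp: prime_elem_def\<close>)

lemma pdvd_prod_linear_power:
  assumes c: "prime_elem c" and "finite A"
    and "\<And>a b. a \<in> A \<Longrightarrow> b \<in> A \<Longrightarrow> a \<noteq> b \<Longrightarrow> \<not> c dvd b - a"
    and "\<And>a. a \<in> A \<Longrightarrow> pdvd c ([:- a, 1:] ^ l a) f"
  shows "pdvd c (\<Prod>a\<in>A. [:- a, 1:] ^ l a) f"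
  using assms(2-)
proof (induction A rule: finite_induct)
  case empty
  show ?case by (auto simp: pdvd_def intro: exI[of _ f])
next
  case (insert b A)
  define P where "P = (\<Prod>a\<in>A. [:- a, 1:] ^ l a)"
  have "pdvd c P f"
    unfolding P_def using insert.prems by (intro insert.IH) auto
  then obtain q where q: "[f = P * q] (pmod c)" by (auto simp: pdvd_def)
  obtain q' where q': "[f = [:- b, 1:] ^ l b * q'] (pmod c)"
    using insert.prems(2)[of b] by (auto simp: pdvd_def)
  have "\<not> c dvd poly P b"
    unfolding P_def using insert by (intro not_dvd_poly_prod_linear_power c) auto
  moreover have "pdvd c ([:- b, 1:] ^ l b) (P * q)"
    unfolding pdvd_def using pcong_trans[OF pcong_sym[OF q] q'] by blast
  ultimately have "pdvd c ([:- b, 1:] ^ l b) q" using pdvd_linear_power_cancel[OF c] by blast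
  then obtain q'' where q'': "[q = [:- b, 1:] ^ l b * q''] (pmod c)" by (auto simp: pdvd_def)
  note q
  also have "[P * q = P * ([:- b, 1:] ^ l b * q'')] (pmod c)" by (intro pcong_mult pcong_refl q'')
  also have "P * ([:- b, 1:] ^ l b * q'') = (\<Prod>a\<in>insert b A. [:- a, 1:] ^ l a) * q''"
    using insert.hyps by (simp add: P_def mult_ac)
  finally show ?case unfolding pdvd_def by blast
qed

lemma degree_le_if_pdvd_monic:
  assumes M: "lead_coeff M = 1" and "pdvd c M f" and f: "\<not> [f = 0] (pmod c)"
  shows "degree M \<le> degree f"
proof -
  obtain q where q: "[f = M * q] (pmod c)" using assms(2) by (auto simp: pdvd_def)
  define r where "r = map_poly (\<lambda>x. if c dvd x then 0 else x) q"
  have coeff_r: "coeff r n = (if c dvd coeff q n then 0 else coeff q n)" for n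
    by (simp add: r_def coeff_map_poly)
  have "[q = r] (pmod c)" by (simp add: pcong_iff_coeff coeff_r)
  with q have fr: "[f = M * r] (pmod c)"
    using pcong_mult[OF pcong_refl] pcong_trans by blast
  hence "r \<noteq> 0" using f by auto
  hence "\<not> c dvd lead_coeff r" by (metis coeff_r dvd_0_right leading_coeff_0_iff)
  moreover have "coeff (M * r) (degree M + degree r) = lead_coeff r"
    using M by (simp add: coeff_mult_degree_sum)
  ultimately have "\<not> c dvd coeff f (degree M + degree r)"
    using fr by (metis pcong_iff_coeff dvd_diff_right_iff)
  hence "degree M + degree r \<le> degree f" by (metis dvd_0_right le_degree)
  thus ?thesis by simp
qed

lemma sum_multiplicities_le_degree:
  assumes c: "prime_elem c" and "finite A"
    and "\<And>a b. a \<in> A \<Longrightarrow> b \<in> A \<Longrightarrow> a \<noteq> b \<Longrightarrow> \<not> c dvd b - a"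
    and "\<And>a. a \<in> A \<Longrightarrow> pdvd c ([:- a, 1:] ^ l a) f"
    and f: "\<not> [f = 0] (pmod c)"
  shows "sum l A \<le> degree f"
proof -
  let ?M = "\<Prod>a\<in>A. [:- a, 1:] ^ l a"
  have "lead_coeff ?M = 1" by (simp add: lead_coeff_prod lead_coeff_power)
  moreover have "pdvd c ?M f" using assms(1-4) by (rule pdvd_prod_linear_power)
  ultimately have "degree ?M \<le> degree f" using f by (rule degree_le_if_pdvd_monic)
  moreover have "degree ?M = (\<Sum>a\<in>A. degree ([:- a, 1:] ^ l a))" by (rule degree_prod_sum_eq) auto
  ultimately show ?thesis by (simp add: degree_power_eq)
qed

lemma higher_pderiv_pcompose_linear:
  "(pderiv ^^ i) (pcompose f [:a, 1:]) = pcompose ((pderiv ^^ i) f) [:a, 1:]"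
  by (induction i) (simp_all add: pderiv_pcompose pderiv_pCons)

lemma pdvd_monom_if_dvd_coeffs:
  assumes "\<And>i. i < l \<Longrightarrow> c dvd coeff f i"
  shows "pdvd c (monom 1 l) f"
proof -
  have "[f = monom 1 l * poly_shift l f] (pmod c)"
    using assms by (auto simp: pcong_iff_coeff coeff_poly_shift coeff_monom_mult)
  thus ?thesis by (auto simp: pdvd_def)
qed

lemma pcompose_monom_linear: "pcompose (monom 1 l) [:a, 1:] = [:a, 1:] ^ l"
  by (induction l) (simp_all add: monom_Suc pcompose_pCons monom_0 del: mult_pCons_left)

lemma pcong_pcompose:
  assumes "[f = g] (pmod c)"
  shows "[pcompose f h = pcompose g h] (pmod c)"
proof -
  obtain q where "f - g = [:c:] * q" using assms by (auto simp: pcong_def)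
  hence "pcompose f h - pcompose g h = [:c:] * pcompose q h"
    by (simp flip: pcompose_diff add: pcompose_smult)
  thus ?thesis unfolding pcong_def by (metis dvd_triv_left)
qed

lemma pdvd_linear_power_if_higher_pderiv:
  fixes p :: nat and f :: "int poly"
  assumes p: "prime p" and "l \<le> p"
    and deriv: "\<And>i. i < l \<Longrightarrow> int p dvd poly ((pderiv ^^ i) f) a"
  shows "pdvd (int p) ([:- a, 1:] ^ l) f"
proof -
  define T where "T = pcompose f [:a, 1:]"
  have "int p dvd coeff T i" if "i < l" for i
  proof -
    have "poly ((pderiv ^^ i) f) a = poly ((pderiv ^^ i) T) 0"
      by (simp add: T_def higher_pderiv_pcompose_linear poly_pcompose)
    also have "\<dots> = int (fact i) * coeff T i"
      by (simp add: poly_0_coeff_0 coeff_higher_pderiv flip: pochhammer_fact)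
    finally have "int p dvd int (fact i) * coeff T i" using deriv[OF that] by metis
    moreover have "\<not> p dvd fact i" using p that assms(2) by (simp add: prime_dvd_fact_iff)
    ultimately show ?thesis
      using p
      by (metis int_dvd_int_iff prime_dvd_multD prime_int_nat_transfer prime_nat_int_transfer)
  qed
  then obtain q where q: "[T = monom 1 l * q] (pmod int p)"
    using pdvd_monom_if_dvd_coeffs[of l "int p" T] by (auto simp: pdvd_def)
  have "f = pcompose T [:- a, 1:]"
    unfolding T_def by (simp flip: pcompose_assoc add: pcompose_pCons)
  also have "[\<dots> = pcompose (monom 1 l * q) [:- a, 1:]] (pmod int p)"
    by (rule pcong_pcompose[OF q])
  also have "pcompose (monom 1 l * q) [:- a, 1:] = [:- a, 1:] ^ l * pcompose q [:- a, 1:]"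
    by (simp add: pcompose_mult pcompose_monom_linear)
  finally show ?thesis unfolding pdvd_def by blast
qed

subsection \<open>Stepanov's method for \<open>y\<^sup>2 = f(x)\<close>\<close>

lemma exists_nontrivial_solution_mod:
  fixes \<Phi> :: "('i \<Rightarrow> int) \<Rightarrow> 'k \<Rightarrow> int" and m :: int
  assumes "finite I" "finite K" "card K < card I" "m > 1"
    and diff: "\<And>c c' k. k \<in> K \<Longrightarrow> \<Phi> (\<lambda>i. c i - c' i) k = \<Phi> c k - \<Phi> c' k"
  shows "\<exists>c. (\<exists>i\<in>I. \<not> m dvd c i) \<and> (\<forall>k\<in>K. m dvd \<Phi> c k)"
proof -
  define A where "A = PiE I (\<lambda>_. {0..<m})"
  define B where "B = PiE K (\<lambda>_. {0..<m})"
  define residues where "residues = (\<lambda>c. restrict (\<lambda>k. \<Phi> c k mod m) K)"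
  have "card A = nat m ^ card I" "card B = nat m ^ card K" "finite B"
    unfolding A_def B_def using assms(1,2) by (auto simp: card_PiE intro!: finite_PiE)
  moreover have "residues ` A \<subseteq> B" using \<open>m > 1\<close> by (auto simp: residues_def B_def)
  ultimately have "card (residues ` A) < card A"
    using card_mono[of B "residues ` A"] power_strict_increasing[OF assms(3), of "nat m"] \<open>m > 1\<close>
    by linarith
  hence "\<not> inj_on residues A" using pigeonhole by blast
  then obtain c c' where c: "c \<in> A" "c' \<in> A" "c \<noteq> c'" "residues c = residues c'"
    by (auto simp: inj_on_def)
  then obtain i where i: "i \<in> I" "c i \<noteq> c' i"
    unfolding A_def by (metis PiE_ext)
  have "c i \<in> {0..<m}" "c' i \<in> {0..<m}" using c i by (auto simp: A_def)
  hence "\<bar>c i - c' i\<bar> < m" by auto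
  hence "\<not> m dvd c i - c' i" using i dvd_imp_le_int[of "c i - c' i" m] by auto
  moreover have "m dvd \<Phi> (\<lambda>i. c i - c' i) k" if "k \<in> K" for k
  proof -
    have "\<Phi> c k mod m = \<Phi> c' k mod m"
      using fun_cong[OF c(4), of k] that by (simp add: residues_def)
    thus ?thesis by (simp add: diff[OF that] mod_eq_dvd_iff)
  qed
  ultimately show ?thesis using i by (intro exI[of _ "\<lambda>i. c i - c' i"]) auto
qed

primrec power_deriv :: "int poly \<Rightarrow> nat \<Rightarrow> nat \<Rightarrow> int poly \<Rightarrow> int poly" where
  "power_deriv f n 0 r = r"
| "power_deriv f n (Suc i) r =
     smult (int (n - i)) (pderiv f * power_deriv f n i r) + f * pderiv (power_deriv f n i r)"

lemma higher_pderiv_power_mult: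
  "i \<le> n \<Longrightarrow> (pderiv ^^ i) (f ^ n * r) = f ^ (n - i) * power_deriv f n i r"
proof (induction i)
  case (Suc i)
  then obtain k where k: "n - i = Suc k" "n - Suc i = k"
    by (metis Suc_diff_Suc Suc_le_eq)
  have "(pderiv ^^ Suc i) (f ^ n * r) = pderiv (f ^ Suc k * power_deriv f n i r)"
    using Suc k by simp
  also have "\<dots> = f ^ k * (smult (int (Suc k)) (pderiv f * power_deriv f n i r) +
      f * pderiv (power_deriv f n i r))"
    unfolding pderiv_mult pderiv_power_Suc
    by (simp add: algebra_simps smult_add_right smult_add_left)
  finally show ?case using k by simp
qed simp

lemma degree_power_deriv_le:
  "degree (power_deriv f n i r) \<le> degree r + i * degree f"
proof (induction i)
  case (Suc i)
  let ?P = "power_deriv f n i r"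
  have "degree (pderiv f * ?P) \<le> degree f + degree ?P"
    by (rule order_trans[OF degree_mult_le]) (simp add: degree_pderiv)
  moreover have "degree (f * pderiv ?P) \<le> degree f + degree ?P"
    by (rule order_trans[OF degree_mult_le]) (simp add: degree_pderiv)
  ultimately have "degree (power_deriv f n (Suc i) r) \<le> degree f + degree ?P"
    by (auto intro!: degree_add_le order_trans[OF degree_smult_le])
  thus ?case using Suc by simp
qed simp

lemma power_deriv_diff:
  "power_deriv f n i (r - s) = power_deriv f n i r - power_deriv f n i s"
  by (induction i) (simp_all add: right_diff_distrib smult_diff_right pderiv_diff)

lemma pcong_pderiv: "[f = g] (pmod c) \<Longrightarrow> [pderiv f = pderiv g] (pmod c)"
  unfolding pcong_iff_coeff coeff_pderiv by (metis dvd_mult right_diff_distrib)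

lemma higher_pderiv_monom_mult_pcong:
  "[(pderiv ^^ i) (monom 1 (p * j) * q) = monom 1 (p * j) * (pderiv ^^ i) q] (pmod int p)"
proof (induction i)
  case (Suc i)
  let ?M = "monom (1::int) (p * j)"
  have "[(pderiv ^^ Suc i) (?M * q) = pderiv (?M * (pderiv ^^ i) q)] (pmod int p)"
    using pcong_pderiv[OF Suc] by simp
  also have "pderiv (?M * (pderiv ^^ i) q) =
      ?M * (pderiv ^^ Suc i) q + (pderiv ^^ i) q * pderiv ?M"
    by (simp add: pderiv_mult)
  also have "[\<dots> = ?M * (pderiv ^^ Suc i) q + (pderiv ^^ i) q * 0] (pmod int p)"
    by (intro pcong_add pcong_mult pcong_refl)
      (auto simp: pderiv_monom pcong_0_iff const_poly_dvd_iff)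
  finally show ?case by simp
qed simp

definition stepanov_poly ::
  "nat \<Rightarrow> int poly \<Rightarrow> nat \<Rightarrow> nat \<Rightarrow> nat \<Rightarrow> (nat \<Rightarrow> int poly) \<Rightarrow> (nat \<Rightarrow> int poly) \<Rightarrow> int poly" where
  "stepanov_poly p f l m J r s = (\<Sum>j<J. monom 1 (p * j) * (f ^ l * r j + f ^ (l + m) * s j))"

text \<open>At points with \<open>f\<^sup>m = 1\<close> and \<open>x\<^sup>p = x\<close>, the \<open>i\<close>-th derivative of the polynomial above
  is the value of this one, up to a power of \<open>f\<close>.\<close>

definition stepanov_deriv ::
  "int poly \<Rightarrow> nat \<Rightarrow> nat \<Rightarrow> nat \<Rightarrow> nat \<Rightarrow> (nat \<Rightarrow> int poly) \<Rightarrow> (nat \<Rightarrow> int poly) \<Rightarrow> int poly" where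
  "stepanov_deriv f l m J i r s =
     (\<Sum>j<J. monom 1 j * (power_deriv f l i (r j) + power_deriv f (l + m) i (s j)))"

lemma power_prime_cong_int:
  assumes "prime p"
  shows "[(x::int) ^ p = x] (mod int p)"
proof (cases "int p dvd x")
  case True
  hence "int p dvd x ^ p"
    using assms prime_gt_0_nat by (simp add: dvd_power_same dvd_trans dvd_power)
  thus ?thesis using True by (simp add: cong_iff_dvd_diff)
next
  case False
  define y where "y = nat (x mod int p)"
  have xy: "[x = int y] (mod int p)"
    using assms prime_gt_0_nat[of p] by (simp add: y_def cong_def)
  hence "\<not> p dvd y" using False cong_dvd_iff[OF xy] by simp
  hence "[int y ^ (p - 1) = 1] (mod int p)"
    using fermat_theorem[OF assms, of y] by (metis cong_int_iff of_nat_1 of_nat_power)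
  hence "[x ^ (p - 1) = 1] (mod int p)" using cong_pow[OF xy] cong_trans by blast
  hence "[x * x ^ (p - 1) = x * 1] (mod int p)" by (intro cong_mult) auto
  thus ?thesis using assms prime_gt_0_nat[of p] by (simp flip: power_Suc)
qed

lemma poly_higher_pderiv_stepanov_poly_cong:
  assumes p: "prime p" and i: "i \<le> l" and x: "[poly f x ^ m = 1] (mod int p)"
  shows "[poly ((pderiv ^^ i) (stepanov_poly p f l m J r s)) x =
    poly f x ^ (l - i) * poly (stepanov_deriv f l m J i r s) x] (mod int p)"
proof -
  let ?D = "\<lambda>n. power_deriv f n i" and ?fx = "poly f x"
  let ?q = "\<lambda>j. f ^ l * r j + f ^ (l + m) * s j"
  have summand: "[poly ((pderiv ^^ i) (monom 1 (p * j) * ?q j)) x =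
      ?fx ^ (l - i) * (x ^ j * (poly (?D l (r j)) x + poly (?D (l + m) (s j)) x))] (mod int p)" for j
  proof -
    have deriv: "(pderiv ^^ i) (?q j) =
        f ^ (l - i) * ?D l (r j) + f ^ (l - i) * f ^ m * ?D (l + m) (s j)"
      using i higher_pderiv_power_mult[of i l f "r j"] higher_pderiv_power_mult[of i "l + m" f "s j"]
      by (simp add: higher_pderiv_add flip: power_add)
    have "[poly ((pderiv ^^ i) (monom 1 (p * j) * ?q j)) x =
        poly (monom 1 (p * j) * (pderiv ^^ i) (?q j)) x] (mod int p)"
      unfolding cong_iff_dvd_diff
      by (rule pcong_imp_dvd_poly_diff[OF higher_pderiv_monom_mult_pcong])
    also have "poly (monom 1 (p * j) * (pderiv ^^ i) (?q j)) x = (x ^ p) ^ j *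
        (?fx ^ (l - i) * poly (?D l (r j)) x + ?fx ^ (l - i) * ?fx ^ m * poly (?D (l + m) (s j)) x)"
      by (simp only: deriv poly_monom power_mult poly_mult poly_add poly_power mult_1)
    also have "[\<dots> = x ^ j * (?fx ^ (l - i) * poly (?D l (r j)) x +
        ?fx ^ (l - i) * 1 * poly (?D (l + m) (s j)) x)] (mod int p)"
      by (intro cong_mult cong_add cong_refl cong_pow power_prime_cong_int p x)
    finally show ?thesis by (simp add: algebra_simps)
  qed
  have "poly ((pderiv ^^ i) (stepanov_poly p f l m J r s)) x =
      (\<Sum>j<J. poly ((pderiv ^^ i) (monom 1 (p * j) * ?q j)) x)"
    by (simp add: stepanov_poly_def higher_pderiv_sum poly_sum)
  also have "[\<dots> = (\<Sum>j<J. ?fx ^ (l - i) *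
      (x ^ j * (poly (?D l (r j)) x + poly (?D (l + m) (s j)) x)))] (mod int p)"
    by (intro cong_sum summand)
  finally show ?thesis by (simp add: stepanov_deriv_def poly_sum poly_monom sum_distrib_left)
qed

lemma prime_dvd_coeff_power:
  assumes "prime p" "0 < i" "i < p"
  shows "int p dvd coeff (f ^ p) i"
proof -
  obtain k where k: "i = Suc k" using assms by (cases i) auto
  obtain p' where p': "p = Suc p'" using assms by (cases p) auto
  have "pderiv (f ^ p) = smult (int p) (f ^ p' * pderiv f)"
    unfolding p' pderiv_power_Suc by simp
  hence "coeff (pderiv (f ^ p)) k = int p * coeff (f ^ p' * pderiv f) k" by simp
  hence "int p dvd int i * coeff (f ^ p) i" unfolding coeff_pderiv k by simp
  moreover have "\<not> int p dvd int i" using assms by (simp add: nat_dvd_not_less)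
  ultimately show ?thesis using assms(1) by (simp add: prime_dvd_mult_iff)
qed

lemma power_prime_pcong:
  assumes p: "prime p"
  shows "\<exists>K. [f ^ p = [:coeff f 0:] + monom 1 p * K] (pmod int p)"
proof -
  have "int p dvd coeff (f ^ p) i - coeff ([:coeff f 0:] + monom 1 p * poly_shift p (f ^ p)) i" for i
  proof (cases "i = 0")
    case True
    have "[coeff f 0 ^ p = coeff f 0] (mod int p)" using p by (rule power_prime_cong_int)
    thus ?thesis
      using True prime_gt_0_nat[OF p]
      by (simp add: coeff_0_power coeff_monom_mult cong_iff_dvd_diff)
  next
    case False
    then obtain k where "i = Suc k" by (cases i) auto
    thus ?thesis
      using prime_dvd_coeff_power[OF p, of i] by (auto simp: coeff_poly_shift coeff_monom_mult)
  qed
  thus ?thesis unfolding pcong_iff_coeff by blast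
qed

lemma pcong_square_linear_descent:
  assumes c: "prime_elem c" and g: "\<not> c dvd poly g a"
    and eq: "[g * u ^ 2 = [:- a, 1:] * h * v ^ 2] (pmod c)"
  obtains u1 where "[u = [:- a, 1:] * u1] (pmod c)" "degree u1 = degree u - 1"
    "[h * v ^ 2 = [:- a, 1:] * g * u1 ^ 2] (pmod c)"
proof
  define X where "X = [:- a, 1:]"
  define u1 where "u1 = synthetic_div u a"
  have "c dvd poly (g * u ^ 2) a - poly (X * h * v ^ 2) a"
    using eq unfolding X_def by (rule pcong_imp_dvd_poly_diff)
  hence "c dvd poly u a"
    using g c prime_elem_dvd_power[of c "poly u a"] by (auto simp: X_def prime_elem_dvd_mult_iff)
  thus u: "[u = [:- a, 1:] * u1] (pmod c)"
    unfolding u1_def by (rule pcong_linear_mult_synthetic_div)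
  show "degree u1 = degree u - 1" by (simp add: u1_def degree_synthetic_div)
  have "X * (h * v ^ 2) = X * h * v ^ 2" by (simp add: mult.assoc)
  also have "[X * h * v ^ 2 = g * u ^ 2] (pmod c)" using eq unfolding X_def by (rule pcong_sym)
  also have "[g * u ^ 2 = g * (X * u1) ^ 2] (pmod c)"
    using u unfolding X_def by (intro pcong_mult pcong_power pcong_refl)
  also have "g * (X * u1) ^ 2 = X * (X * g * u1 ^ 2)" by (simp add: power2_eq_square mult_ac)
  finally show "[h * v ^ 2 = [:- a, 1:] * g * u1 ^ 2] (pmod c)"
    using pcong_mult_cancel_left[OF c] not_pcong_0_linear[OF prime_elem_not_unit[OF c]]
    unfolding X_def by blast
qed

text \<open>The two sides vanish at \<open>a\<close> to an even and an odd order.\<close>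

lemma pcong_0_if_square_mult_simple_root:
  assumes c: "prime_elem c" and b: "\<not> c dvd b" and g: "\<not> c dvd poly g a"
    and "[[:b:] * s ^ 2 = [:- a, 1:] * g * r ^ 2] (pmod c)"
  shows "[s = 0] (pmod c)"
  using assms(4)
proof (induction "degree s" arbitrary: r s rule: less_induct)
  case less
  obtain s1 where s1: "[s = [:- a, 1:] * s1] (pmod c)" "degree s1 = degree s - 1"
      and "[g * r ^ 2 = [:- a, 1:] * [:b:] * s1 ^ 2] (pmod c)"
    using pcong_square_linear_descent[OF c _ less.prems] b by auto
  then obtain r1 where r1: "[[:b:] * s1 ^ 2 = [:- a, 1:] * g * r1 ^ 2] (pmod c)"
    using pcong_square_linear_descent[OF c g] by blast
  show ?case
  proof (cases "degree s = 0")
    case True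
    then obtain d where "s = [:d:]" by (rule degree_eq_zeroE)
    moreover have "c dvd poly s a - poly ([:- a, 1:] * s1) a"
      using s1(1) by (rule pcong_imp_dvd_poly_diff)
    ultimately show ?thesis by (simp add: pcong_0_iff)
  next
    case False
    hence "[s1 = 0] (pmod c)" using less.hyps[OF _ r1] s1(2) by simp
    hence "[[:- a, 1:] * s1 = [:- a, 1:] * 0] (pmod c)" by (intro pcong_mult pcong_refl)
    with s1(1) show ?thesis unfolding mult_zero_right by (rule pcong_trans)
  qed
qed

lemma pcong_0_if_add_monom_mult:
  assumes "degree g < n" "[g + monom 1 n * h = 0] (pmod c)"
  shows "[g = 0] (pmod c)"
  unfolding pcong_iff_coeff
proof
  fix i
  show "c dvd coeff g i - coeff 0 i"
  proof (cases "i < n")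
    case True
    hence "coeff (g + monom 1 n * h) i = coeff g i" by (simp add: coeff_monom_mult)
    thus ?thesis using assms(2) unfolding pcong_iff_coeff by metis
  next
    case False
    thus ?thesis using assms(1) by (simp add: coeff_eq_0)
  qed
qed

lemma stepanov_poly_pcong_factor:
  fixes c :: int
  assumes "j0 < J" and below: "\<And>j. j < j0 \<Longrightarrow> [r j = 0] (pmod c) \<and> [s j = 0] (pmod c)"
  shows "\<exists>R S. [stepanov_poly p f l m J r s = monom 1 (p * j0) * f ^ l *
    ((r j0 + monom 1 p * R) + f ^ m * (s j0 + monom 1 p * S))] (pmod c)"
proof -
  let ?t = "\<lambda>j. monom 1 (p * j) * (f ^ l * r j + f ^ (l + m) * s j)"
  define tail :: "(nat \<Rightarrow> int poly) \<Rightarrow> int poly"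
    where "tail = (\<lambda>q. \<Sum>j\<in>{Suc j0..<J}. monom 1 (p * (j - Suc j0)) * q j)"
  have summand: "?t j = monom 1 (p * j0) * f ^ l * (monom 1 p * (monom 1 (p * (j - Suc j0)) * r j) +
      f ^ m * (monom 1 p * (monom 1 (p * (j - Suc j0)) * s j)))" if "j \<in> {Suc j0..<J}" for j
  proof -
    have "j = j0 + 1 + (j - Suc j0)" using that by simp
    hence "p * j = p * j0 + p + p * (j - Suc j0)" by (metis distrib_left mult.right_neutral)
    hence "monom (1::int) (p * j) = monom 1 (p * j0) * monom 1 p * monom 1 (p * (j - Suc j0))"
      by (simp only: mult_monom mult_1)
    thus ?thesis by (simp only: power_add distrib_left mult_ac)
  qed
  have head: "[sum ?t {..<j0} = 0] (pmod c)"
    unfolding pcong_0_iff using below by (intro dvd_sum dvd_mult dvd_add) (auto simp: pcong_0_iff)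
  have "sum ?t {Suc j0..<J} = (\<Sum>j\<in>{Suc j0..<J}. monom 1 (p * j0) * f ^ l *
      (monom 1 p * (monom 1 (p * (j - Suc j0)) * r j) +
       f ^ m * (monom 1 p * (monom 1 (p * (j - Suc j0)) * s j))))"
    by (intro sum.cong refl summand)
  also have "\<dots> = monom 1 (p * j0) * f ^ l * (monom 1 p * tail r + f ^ m * (monom 1 p * tail s))"
    by (simp only: tail_def sum_distrib_left sum.distrib distrib_left)
  finally have "sum ?t {j0..<J} = ?t j0 +
      monom 1 (p * j0) * f ^ l * (monom 1 p * tail r + f ^ m * (monom 1 p * tail s))"
    by (simp only: sum.atLeast_Suc_lessThan[OF assms(1)])
  hence "sum ?t {j0..<J} = monom 1 (p * j0) * f ^ l *
      ((r j0 + monom 1 p * tail r) + f ^ m * (s j0 + monom 1 p * tail s))"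
    by (simp only: power_add distrib_left mult_ac add_ac)
  moreover have "stepanov_poly p f l m J r s = sum ?t {..<j0} + sum ?t {j0..<J}"
    using assms(1) unfolding stepanov_poly_def lessThan_atLeast0
    by (intro sum.atLeastLessThan_concat[symmetric]) auto
  ultimately have "[stepanov_poly p f l m J r s = 0 + monom 1 (p * j0) * f ^ l *
      ((r j0 + monom 1 p * tail r) + f ^ m * (s j0 + monom 1 p * tail s))] (pmod c)"
    by (simp only: pcong_add[OF head pcong_refl])
  thus ?thesis unfolding add_0_left by blast
qed

text \<open>Multiplying \<open>\<rho> + f\<^sup>m \<sigma>\<close> by \<open>f (\<rho> - f\<^sup>m \<sigma>)\<close> gives \<open>\<rho>\<^sup>2 f - f\<^sup>p \<sigma>\<^sup>2\<close>, and \<open>f\<^sup>p\<close> is constant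
  modulo \<open>x\<^sup>p\<close>.\<close>

lemma stepanov_relation_mod_monom:
  assumes p: "prime p" "p = 2 * m + 1"
    and deg: "2 * degree r + degree f < p" "2 * degree s < p"
    and zero: "[(r + monom 1 p * R) + f ^ m * (s + monom 1 p * S) = 0] (pmod int p)"
  shows "[[:coeff f 0:] * s ^ 2 = f * r ^ 2] (pmod int p)"
proof -
  define Y where "Y = monom (1::int) p"
  define \<rho> where "\<rho> = r + Y * R"
  define \<sigma> where "\<sigma> = s + Y * S"
  define b where "b = [:coeff f 0:]"
  obtain K where K: "[f ^ p = b + Y * K] (pmod int p)"
    using power_prime_pcong[OF p(1)] unfolding Y_def b_def by blast
  define Z where "Z = 2 * r * R * f + Y * R ^ 2 * f - K * \<sigma> ^ 2 - b * (2 * s * S + Y * S ^ 2)"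
  have "(f * r ^ 2 - b * s ^ 2) + Y * Z = f * \<rho> ^ 2 - (b + Y * K) * \<sigma> ^ 2"
    unfolding Z_def \<rho>_def \<sigma>_def by (simp only: power2_eq_square algebra_simps)
  also have "[\<dots> = f * \<rho> ^ 2 - f ^ p * \<sigma> ^ 2] (pmod int p)"
    by (intro pcong_diff pcong_mult pcong_refl pcong_sym[OF K])
  also have "f * \<rho> ^ 2 - f ^ p * \<sigma> ^ 2 = f * (\<rho> - f ^ m * \<sigma>) * (\<rho> + f ^ m * \<sigma>)"
    unfolding p(2) power_add mult_2 by (simp add: algebra_simps power2_eq_square)
  also have "[\<dots> = f * (\<rho> - f ^ m * \<sigma>) * 0] (pmod int p)"
    using zero unfolding \<rho>_def \<sigma>_def Y_def by (intro pcong_mult pcong_refl)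
  finally have "[(f * r ^ 2 - b * s ^ 2) + Y * Z = 0] (pmod int p)" by simp
  moreover have "degree (f * r ^ 2 - b * s ^ 2) < p"
  proof (rule degree_diff_less)
    show "degree (f * r ^ 2) < p"
      using deg(1) degree_mult_le[of f "r ^ 2"] degree_power_le[of r 2] by linarith
    show "degree (b * s ^ 2) < p"
      using deg(2) degree_mult_le[of b "s ^ 2"] degree_power_le[of s 2]
      by (simp only: b_def degree_pCons_0)
  qed
  ultimately have "[f * r ^ 2 - b * s ^ 2 = 0] (pmod int p)"
    unfolding Y_def by (rule pcong_0_if_add_monom_mult[rotated])
  hence "[f * r ^ 2 = b * s ^ 2] (pmod int p)" by (simp add: pcong_def)
  thus ?thesis unfolding b_def by (rule pcong_sym)
qed

lemma stepanov_poly_not_pcong_0: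
  assumes p: "prime p" "odd p" and f: "f = [:- a, 1:] * f1" and f1: "\<not> int p dvd poly f1 a"
    and f0: "\<not> int p dvd coeff f 0"
    and deg: "\<And>j. j < J \<Longrightarrow> 2 * degree (r j) + degree f < p" "\<And>j. j < J \<Longrightarrow> 2 * degree (s j) < p"
    and nonzero: "\<exists>j<J. \<not> ([r j = 0] (pmod int p) \<and> [s j = 0] (pmod int p))"
  shows "\<not> [stepanov_poly p f l ((p - 1) div 2) J r s = 0] (pmod int p)"
proof
  let ?m = "(p - 1) div 2"
  let ?nonzero = "\<lambda>j. j < J \<and> \<not> ([r j = 0] (pmod int p) \<and> [s j = 0] (pmod int p))"
  assume zero: "[stepanov_poly p f l ?m J r s = 0] (pmod int p)"
  have pe: "prime_elem (int p)" using p(1) by simp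
  have monom: "\<not> [monom 1 (p * j) = 0] (pmod int p)" for j
    using prime_gt_1_nat[OF p(1)] by (auto simp: pcong_iff_coeff)
  have f_nz: "\<not> [f = 0] (pmod int p)" using f0 by (auto simp: pcong_iff_coeff)
  hence power_nz: "\<not> [f ^ l = 0] (pmod int p)" using pcong_power_0D[OF pe] by blast
  define j0 where "j0 = (LEAST j. ?nonzero j)"
  have j0: "j0 < J" "\<not> ([r j0 = 0] (pmod int p) \<and> [s j0 = 0] (pmod int p))"
    using LeastI_ex[OF nonzero] unfolding j0_def by auto
  have "[r j = 0] (pmod int p) \<and> [s j = 0] (pmod int p)" if "j < j0" for j
    using not_less_Least[of j ?nonzero] that j0(1) unfolding j0_def[symmetric] by auto
  then obtain R S where "[stepanov_poly p f l ?m J r s = monom 1 (p * j0) * f ^ l *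
      ((r j0 + monom 1 p * R) + f ^ ?m * (s j0 + monom 1 p * S))] (pmod int p)"
    using stepanov_poly_pcong_factor[OF j0(1), of r "int p" s p f l ?m] by blast
  hence "[monom 1 (p * j0) * (f ^ l *
      ((r j0 + monom 1 p * R) + f ^ ?m * (s j0 + monom 1 p * S))) = 0] (pmod int p)"
    unfolding mult.assoc by (rule pcong_trans[OF pcong_sym zero])
  hence "[(r j0 + monom 1 p * R) + f ^ ?m * (s j0 + monom 1 p * S) = 0] (pmod int p)"
    using monom power_nz unfolding pcong_mult_0_iff[OF pe] by blast
  moreover have "p = 2 * ?m + 1" using p(2) by (auto elim!: oddE)
  ultimately have square: "[[:coeff f 0:] * s j0 ^ 2 = f * r j0 ^ 2] (pmod int p)"
    using deg[OF j0(1)] p(1) by (intro stepanov_relation_mod_monom)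
  have s0: "[s j0 = 0] (pmod int p)"
    using square by (intro pcong_0_if_square_mult_simple_root[OF pe f0 f1]) (simp only: f)
  have "[f * r j0 ^ 2 = [:coeff f 0:] * 0 ^ 2] (pmod int p)"
    by (rule pcong_trans[OF pcong_sym[OF square]]) (intro pcong_mult pcong_power pcong_refl s0)
  hence "[f * r j0 ^ 2 = 0] (pmod int p)" by simp
  hence "[r j0 = 0] (pmod int p)"
    using f_nz pcong_power_0D[OF pe] unfolding pcong_mult_0_iff[OF pe] by blast
  with s0 j0(2) show False by simp
qed

definition poly_of_fun :: "nat \<Rightarrow> (nat \<Rightarrow> 'a::comm_monoid_add) \<Rightarrow> 'a poly"
  where "poly_of_fun n a = (\<Sum>i<n. monom (a i) i)"

lemma coeff_poly_of_fun: "coeff (poly_of_fun n a) i = (if i < n then a i else 0)"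
  by (simp add: poly_of_fun_def coeff_sum)

lemma degree_poly_of_fun_less: "n > 0 \<Longrightarrow> degree (poly_of_fun n a) < n"
  by (intro degree_lessI) (auto simp: coeff_poly_of_fun)

lemma poly_of_fun_diff:
  "poly_of_fun n (\<lambda>i. a i - b i :: 'a::ab_group_add) = poly_of_fun n a - poly_of_fun n b"
  by (rule poly_eqI) (simp add: coeff_poly_of_fun)

lemma stepanov_deriv_diff:
  "stepanov_deriv f l m J i (\<lambda>j. r j - r' j) (\<lambda>j. s j - s' j) =
    stepanov_deriv f l m J i r s - stepanov_deriv f l m J i r' s'"
  by (simp add: stepanov_deriv_def power_deriv_diff algebra_simps flip: sum_subtractf)

lemma degree_stepanov_deriv_less:
  assumes "J > 0" "\<And>j. degree (r j) < B" "\<And>j. degree (s j) < B"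
  shows "degree (stepanov_deriv f l m J i r s) < J + B + i * degree f"
proof -
  have power: "degree (power_deriv f n i q) \<le> (B - 1) + i * degree f" if "degree q < B" for n q
    using degree_power_deriv_le[of f n i q] that by linarith
  have "degree (stepanov_deriv f l m J i r s) \<le> (J - 1) + ((B - 1) + i * degree f)"
    unfolding stepanov_deriv_def
    by (intro degree_sum_le order_trans[OF degree_mult_le] add_mono order_trans[OF degree_monom_le]
        degree_add_le power assms) auto
  thus ?thesis using assms(1) assms(2)[of 0] by linarith
qed

lemma exists_stepanov_coefficients:
  assumes m: "m > (1::int)" and B: "B > 0" and J: "J > 0" and deg: "degree f \<le> d"
    and count: "l * (J + B + l * d) < 2 * J * B"
  shows "\<exists>r s. (\<forall>j. degree (r j) < B \<and> degree (s j) < B) \<and>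
    (\<exists>j<J. \<not> ([r j = 0] (pmod m) \<and> [s j = 0] (pmod m))) \<and>
    (\<forall>i<l. [stepanov_deriv f l n J i r s = 0] (pmod m))"
proof -
  define I where "I = {..<J} \<times> {..<B} \<times> (UNIV :: bool set)"
  define K where "K = {..<l} \<times> {..<J + B + l * d}"
  define q :: "(nat \<times> nat \<times> bool \<Rightarrow> int) \<Rightarrow> bool \<Rightarrow> nat \<Rightarrow> int poly"
    where "q = (\<lambda>c (t::bool) j. poly_of_fun B (\<lambda>b. c (j, b, t)))"
  have deg_q: "degree (q c t j) < B" for c t j
    unfolding q_def using B by (rule degree_poly_of_fun_less)
  define \<Phi> where "\<Phi> = (\<lambda>c (i, t). coeff (stepanov_deriv f l n J i (q c True) (q c False)) t)"
  have "\<exists>c. (\<exists>i\<in>I. \<not> m dvd c i) \<and> (\<forall>k\<in>K. m dvd \<Phi> c k)"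
  proof (rule exists_nontrivial_solution_mod)
    show "card K < card I"
      using count by (simp add: K_def I_def card_cartesian_product algebra_simps)
    show "\<Phi> (\<lambda>i. c i - c' i) k = \<Phi> c k - \<Phi> c' k" for c c' k
      by (cases k) (simp add: \<Phi>_def q_def poly_of_fun_diff stepanov_deriv_diff)
  qed (use m in \<open>auto simp: I_def K_def\<close>)
  then obtain c where c: "\<exists>i\<in>I. \<not> m dvd c i" "\<And>k. k \<in> K \<Longrightarrow> m dvd \<Phi> c k" by blast
  from c(1) obtain j b t where j: "j < J" and "b < B" "\<not> m dvd c (j, b, t)" by (auto simp: I_def)
  hence "\<not> m dvd coeff (q c t j) b" by (simp add: q_def coeff_poly_of_fun)
  hence "\<not> [q c t j = 0] (pmod m)" by (auto simp: pcong_iff_coeff)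
  hence "\<not> ([q c True j = 0] (pmod m) \<and> [q c False j = 0] (pmod m))" by (cases t) auto
  moreover have "[stepanov_deriv f l n J i (q c True) (q c False) = 0] (pmod m)" if i: "i < l" for i
  proof -
    let ?D = "stepanov_deriv f l n J i (q c True) (q c False)"
    have "i * degree f \<le> l * d" using i deg by (intro mult_le_mono) auto
    hence "degree ?D < J + B + l * d"
      using degree_stepanov_deriv_less[OF J deg_q deg_q, where f = f and i = i]
      by (meson add_left_mono order_less_le_trans)
    hence "m dvd coeff ?D t" for t
      using c(2)[of "(i, t)"] i by (cases "t < J + B + l * d") (auto simp: K_def \<Phi>_def coeff_eq_0)
    thus ?thesis by (simp add: pcong_iff_coeff)
  qed
  ultimately show ?thesis using j deg_q
    by (intro exI[of _ "q c True"] exI[of _ "q c False"]) blast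
qed

lemma degree_stepanov_poly_le:
  assumes "\<And>j. degree (r j) < B" "\<And>j. degree (s j) < B" "degree f \<le> d"
  shows "degree (stepanov_poly p f l m J r s) \<le> p * (J - 1) + (d * (l + m) + B)"
  unfolding stepanov_poly_def
proof (rule degree_sum_le)
  fix j assume j: "j \<in> {..<J}"
  have pow: "degree (f ^ n) \<le> d * (l + m)" if "n \<le> l + m" for n
    using degree_power_le[of f n] mult_le_mono[OF assms(3) that] by linarith
  have "degree (f ^ l * r j) \<le> d * (l + m) + B" "degree (f ^ (l + m) * s j) \<le> d * (l + m) + B"
    using assms(1,2)[of j] by (auto intro!: order_trans[OF degree_mult_le] add_mono pow)
  hence "degree (f ^ l * r j + f ^ (l + m) * s j) \<le> d * (l + m) + B" by (rule degree_add_le)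
  moreover have "degree (monom (1::int) (p * j)) \<le> p * (J - 1)"
    using j by (intro order_trans[OF degree_monom_le] mult_le_mono2) auto
  ultimately show "degree (monom 1 (p * j) * (f ^ l * r j + f ^ (l + m) * s j)) \<le>
      p * (J - 1) + (d * (l + m) + B)"
    by (intro order_trans[OF degree_mult_le] add_mono)
qed auto

definition residue_points :: "nat \<Rightarrow> int poly \<Rightarrow> int set" where
  "residue_points p f = {x \<in> {0..<int p}. Legendre (poly f x) (int p) = 1}"

lemma finite_residue_points: "finite (residue_points p f)"
  by (rule finite_subset[of _ "{0..<int p}"]) (auto simp: residue_points_def)

lemma Legendre_eq_1_imp_cong:
  assumes "prime p" "odd p" "Legendre a (int p) = 1"
  shows "[a ^ ((p - 1) div 2) = 1] (mod int p)"
proof -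
  have "p > 2" using assms(1,2) prime_ge_2_nat[of p] by (cases "p = 2") auto
  thus ?thesis using euler_criterion[OF assms(1), of a] assms(3) by (simp add: cong_sym)
qed

lemma not_dvd_diff_residues:
  fixes p :: int
  assumes "a \<in> {0..<p}" "b \<in> {0..<p}" "a \<noteq> b"
  shows "\<not> p dvd b - a"
proof
  assume "p dvd b - a"
  hence "p \<le> \<bar>b - a\<bar>" using assms(3) dvd_imp_le_int[of "b - a" p] assms(1) by simp
  thus False using assms by auto
qed

lemma pdvd_stepanov_poly:
  assumes p: "prime p" "odd p" and "l \<le> p" and x: "x \<in> residue_points p f"
    and deriv: "\<And>i. i < l \<Longrightarrow> [stepanov_deriv f l ((p - 1) div 2) J i r s = 0] (pmod int p)"
  shows "pdvd (int p) ([:- x, 1:] ^ l) (stepanov_poly p f l ((p - 1) div 2) J r s)"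
proof (rule pdvd_linear_power_if_higher_pderiv[OF p(1) \<open>l \<le> p\<close>])
  let ?m = "(p - 1) div 2"
  let ?h = "stepanov_poly p f l ?m J r s" and ?D = "\<lambda>i. stepanov_deriv f l ?m J i r s"
  fix i assume i: "i < l"
  have "[poly f x ^ ?m = 1] (mod int p)"
    using x Legendre_eq_1_imp_cong[OF p] by (simp add: residue_points_def)
  hence "[poly ((pderiv ^^ i) ?h) x = poly f x ^ (l - i) * poly (?D i) x] (mod int p)"
    using i by (intro poly_higher_pderiv_stepanov_poly_cong p) auto
  moreover have "int p dvd poly (?D i) x"
    using pcong_imp_dvd_poly_diff[OF deriv[OF i], of x] by simp
  ultimately show "int p dvd poly ((pderiv ^^ i) ?h) x"
    by (simp only: cong_iff_dvd_diff) (metis dvd_add diff_add_cancel dvd_mult)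
qed

lemma card_residue_points_le_degree:
  assumes p: "prime p" "odd p" and f: "f = [:- a, 1:] * f1" and f1: "\<not> int p dvd poly f1 a"
    and f0: "\<not> int p dvd coeff f 0" and deg: "degree f \<le> d"
    and B: "B > 0" "2 * B + d \<le> p" and J: "J > 0" and l: "l \<le> p"
    and count: "l * (J + B + l * d) < 2 * J * B"
  shows "l * card (residue_points p f) \<le> p * (J - 1) + (d * (l + (p - 1) div 2) + B)"
proof -
  let ?m = "(p - 1) div 2"
  have "int p > 1" using prime_gt_1_nat[OF p(1)] by simp
  then obtain r s where deg_rs: "\<And>j. degree (r j) < B" "\<And>j. degree (s j) < B"
      and nonzero: "\<exists>j<J. \<not> ([r j = 0] (pmod int p) \<and> [s j = 0] (pmod int p))"
      and deriv: "\<And>i. i < l \<Longrightarrow> [stepanov_deriv f l ?m J i r s = 0] (pmod int p)"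
    using exists_stepanov_coefficients[OF _ B(1) J deg count, of "int p" ?m] by blast
  let ?h = "stepanov_poly p f l ?m J r s"
  have "(\<Sum>x\<in>residue_points p f. l) \<le> degree ?h"
  proof (rule sum_multiplicities_le_degree)
    show "prime_elem (int p)" using p(1) by simp
    show "finite (residue_points p f)" by (rule finite_residue_points)
    show "\<not> int p dvd b - a"
      if "a \<in> residue_points p f" "b \<in> residue_points p f" "a \<noteq> b" for a b
      using that by (intro not_dvd_diff_residues) (auto simp: residue_points_def)
    show "pdvd (int p) ([:- x, 1:] ^ l) ?h" if "x \<in> residue_points p f" for x
      using p l that deriv by (rule pdvd_stepanov_poly)
    have deg_small: "2 * degree (r j) + degree f < p" "2 * degree (s j) < p" for j
      using deg_rs[of j] B deg by linarith+
    show "\<not> [?h = 0] (pmod int p)"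
      by (rule stepanov_poly_not_pcong_0[OF p f f1 f0 deg_small nonzero])
  qed
  also have "degree ?h \<le> p * (J - 1) + (d * (l + ?m) + B)"
    by (rule degree_stepanov_poly_le[OF deg_rs deg])
  finally show ?thesis by (simp only: sum_constant of_nat_id mult.commute)
qed

text \<open>Multiplicity \<open>l = 2t\<close> and \<open>J = t + 2d + 1\<close>, so that the number of conditions falls short of
  the number \<open>2JB\<close> of coefficients by \<open>2(2d + 1)(B - t\<^sup>2 - t)\<close>.\<close>

lemma card_residue_points_le_of_parameter:
  assumes p: "prime p" "odd p" and f: "f = [:- a, 1:] * f1" and f1: "\<not> int p dvd poly f1 a"
    and f0: "\<not> int p dvd coeff f 0" and deg: "degree f \<le> d" and d: "d \<ge> 1"
    and t: "4 * t ^ 2 \<le> p" "4 * (d + 1 + 2 * t) \<le> p"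
  shows "4 * t * card (residue_points p f) \<le> 2 * p * t + 6 * d * p + 4 * d * t"
proof -
  let ?n = "card (residue_points p f)" and ?m = "(p - 1) div 2"
  define B where "B = (p - d) div 2"
  define J where "J = t + 2 * d + 1"
  have "d + 2 * (t ^ 2 + t + 1) \<le> p" using t by simp
  hence "t ^ 2 + t + 1 \<le> B" unfolding B_def by simp
  then obtain b where b: "B = t ^ 2 + t + 1 + b" using le_Suc_ex by blast
  have "2 * t * (J + B + 2 * t * d) < 2 * J * B"
    unfolding J_def b by (simp add: algebra_simps power2_eq_square)
  moreover have "B > 0" "2 * B + d \<le> p" "J > 0" "2 * t \<le> p"
    using b t unfolding B_def J_def by linarith+
  ultimately have "2 * t * ?n \<le> p * (J - 1) + (d * (2 * t + ?m) + B)"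
    by (intro card_residue_points_le_degree[OF p f f1 f0 deg])
  hence "2 * (2 * t * ?n) \<le> 2 * (p * (J - 1) + (d * (2 * t + ?m) + B))" by (rule mult_le_mono2)
  also have "\<dots> = 2 * (p * (t + 2 * d)) + (4 * d * t + d * (2 * ?m) + 2 * B)"
    by (simp add: J_def algebra_simps)
  also have "\<dots> \<le> 2 * (p * (t + 2 * d)) + (4 * d * t + d * p + d * p)"
  proof (intro add_left_mono add_mono mult_left_mono)
    show "2 * B \<le> d * p" using mult_le_mono1[OF d, of p] unfolding B_def by linarith
  qed simp_all
  also have "\<dots> = 2 * p * t + 6 * d * p + 4 * d * t" by (simp add: algebra_simps)
  finally show ?thesis by simp
qed

lemma card_residue_points_le:
  assumes p: "prime p" "odd p" and f: "f = [:- a, 1:] * f1" and f1: "\<not> int p dvd poly f1 a"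
    and f0: "\<not> int p dvd coeff f 0" and deg: "degree f \<le> d" and d: "d \<ge> 1"
  shows "card (residue_points p f) \<le> p / 2 + 13 * real d * sqrt p"
proof (cases "sqrt p \<le> 26 * d")
  case True
  have "card (residue_points p f) \<le> card {0..<int p}"
    by (intro card_mono) (auto simp: residue_points_def)
  hence "real (card (residue_points p f)) \<le> p" by simp
  moreover have "sqrt p * sqrt p \<le> 26 * real d * sqrt p" using True by (intro mult_right_mono) auto
  ultimately show ?thesis by simp
next
  case False
  define t where "t = nat \<lfloor>sqrt p / 4\<rfloor>"
  have large: "sqrt p > 26 * d" "real d \<ge> 1" using False d by auto
  have t: "sqrt p / 8 \<le> t" "t \<le> sqrt p / 4" "t > 0" unfolding t_def using large by linarith+
  have "real t ^ 2 \<le> (sqrt p / 4) ^ 2" using t by (intro power_mono) auto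
  hence "real (4 * t ^ 2) \<le> real p" by (simp add: power_divide)
  hence four_t2: "4 * t ^ 2 \<le> p" by (simp only: of_nat_le_iff)
  have "26 * sqrt p \<le> sqrt p * sqrt p" using large by (intro mult_right_mono) auto
  hence "real (4 * (d + 1 + 2 * t)) \<le> real p" using large t by simp
  hence "4 * (d + 1 + 2 * t) \<le> p" by (simp only: of_nat_le_iff)
  hence "4 * t * card (residue_points p f) \<le> 2 * p * t + 6 * d * p + 4 * d * t"
    by (rule card_residue_points_le_of_parameter[OF p f f1 f0 deg d four_t2])
  hence "real (4 * t * card (residue_points p f)) \<le> real (2 * p * t + 6 * d * p + 4 * d * t)"
    by (simp only: of_nat_le_iff)
  hence "card (residue_points p f) \<le> p / 2 + 3 / 2 * real d * (p / t) + d"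
    using t(3) by (simp add: field_simps)
  also have "3 / 2 * real d * (p / t) \<le> 3 / 2 * real d * (8 * sqrt p)"
  proof (rule mult_left_mono)
    have "sqrt p * (sqrt p / 8) \<le> sqrt p * t" using t(1) by (intro mult_left_mono) auto
    thus "p / t \<le> 8 * sqrt p" using t(3) by (simp add: field_simps)
  qed simp
  finally have "card (residue_points p f) \<le> p / 2 + 12 * real d * sqrt p + d" by simp
  moreover have "real d * 1 \<le> real d * sqrt p" using large by (intro mult_left_mono) linarith+
  ultimately show ?thesis by simp
qed

subsection \<open>Runs of the Legendre symbol\<close>

lemma Legendre_cong: "[a = b] (mod p) \<Longrightarrow> Legendre a p = Legendre b p"
  by (simp add: Legendre_def QuadRes_def cong_def)

lemma Legendre_range: "Legendre a p \<in> {-1, 0, 1}"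
  by (auto simp: Legendre_def)

lemma Legendre_eq_0_iff: "Legendre a p = 0 \<longleftrightarrow> p dvd a"
  by (auto simp: Legendre_def cong_0_iff)

lemma Legendre_1: "p > 1 \<Longrightarrow> Legendre 1 p = 1"
  by (auto simp: Legendre_def QuadRes_def cong_def intro!: exI[of _ 1])

lemma cong_small_imp_eq:
  fixes p :: int
  assumes "[a = b] (mod p)" "\<bar>a - b\<bar> < p"
  shows "a = b"
  using assms dvd_imp_le_int[of "a - b" p] by (force simp: cong_iff_dvd_diff)

lemma Legendre_mult:
  assumes "prime p" "2 < p"
  shows "Legendre (a * b) (int p) = Legendre a (int p) * Legendre b (int p)"
proof (rule cong_small_imp_eq)
  let ?m = "(p - 1) div 2"
  have "[Legendre (a * b) (int p) = a ^ ?m * b ^ ?m] (mod int p)"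
    using euler_criterion[OF assms, of "a * b"] by (simp add: power_mult_distrib)
  also have "[a ^ ?m * b ^ ?m = Legendre a (int p) * Legendre b (int p)] (mod int p)"
    by (intro cong_mult cong_sym[OF euler_criterion[OF assms]])
  finally show "[Legendre (a * b) (int p) = Legendre a (int p) * Legendre b (int p)] (mod int p)" .
  show "\<bar>Legendre (a * b) (int p) - Legendre a (int p) * Legendre b (int p)\<bar> < int p"
    using Legendre_range[of a "int p"] Legendre_range[of b "int p"]
      Legendre_range[of "a * b" "int p"] assms by auto
qed

lemma Legendre_prod:
  assumes "prime p" "2 < p"
  shows "Legendre (\<Prod>i\<in>T. f i) (int p) = (\<Prod>i\<in>T. Legendre (f i) (int p))"
  by (induction T rule: infinite_finite_induct)
    (use assms in \<open>simp_all add: Legendre_1 Legendre_mult\<close>)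

lemma sum_Legendre_eq:
  assumes "finite S"
  shows "(\<Sum>x\<in>S. Legendre (g x) p) =
    2 * int (card {x \<in> S. Legendre (g x) p = 1}) + int (card {x \<in> S. p dvd g x}) - int (card S)"
proof -
  have "Legendre v p = 2 * of_bool (Legendre v p = 1) + of_bool (p dvd v) - 1" for v
    using Legendre_range[of v p] Legendre_eq_0_iff[of v p] by auto
  hence "(\<Sum>x\<in>S. Legendre (g x) p) =
      (\<Sum>x\<in>S. 2 * of_bool (Legendre (g x) p = 1) + of_bool (p dvd g x) - 1)"
    by (intro sum.cong refl)
  also have "\<dots> = 2 * int (card (S \<inter> {x. Legendre (g x) p = 1})) +
      int (card (S \<inter> {x. p dvd g x})) - int (card S)"
    using assms by (simp add: sum.distrib sum_subtractf flip: sum_distrib_left)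
  finally show ?thesis by (simp add: Int_def)
qed

lemma card_roots_mod_prime_le_degree:
  fixes p :: int
  assumes "prime p" and f: "\<not> [f = 0] (pmod p)"
  shows "card {x \<in> {0..<p}. p dvd poly f x} \<le> degree f"
proof -
  let ?A = "{x \<in> {0..<p}. p dvd poly f x}"
  have "pdvd p ([:- x, 1:] ^ 1) f" if "x \<in> ?A" for x
    unfolding pdvd_def power_one_right using that pcong_linear_mult_synthetic_div by blast
  moreover have "finite ?A" by (rule finite_subset[of _ "{0..<p}"]) auto
  moreover have "\<not> p dvd b - a" if "a \<in> ?A" "b \<in> ?A" "a \<noteq> b" for a b
    using that by (intro not_dvd_diff_residues) auto
  ultimately have "(\<Sum>x\<in>?A. 1) \<le> degree f"
    using assms by (intro sum_multiplicities_le_degree[of p ?A _ f]) auto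
  thus ?thesis by simp
qed

lemma sum_Legendre_poly_le:
  assumes p: "prime p" "odd p" and f: "f = [:- a, 1:] * f1" and f1: "\<not> int p dvd poly f1 a"
    and f0: "\<not> int p dvd coeff f 0" and deg: "degree f \<le> d" and d: "d \<ge> 1"
  shows "(\<Sum>x\<in>{0..<int p}. Legendre (poly f x) (int p)) \<le> 27 * real d * sqrt p"
proof -
  have "\<not> [f = 0] (pmod int p)" using f0 by (auto simp: pcong_iff_coeff)
  hence "card {x \<in> {0..<int p}. int p dvd poly f x} \<le> d"
    using card_roots_mod_prime_le_degree[of "int p" f] p(1) deg by simp
  moreover have "(\<Sum>x\<in>{0..<int p}. Legendre (poly f x) (int p)) =
      2 * int (card (residue_points p f)) + int (card {x \<in> {0..<int p}. int p dvd poly f x}) - int p"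
    unfolding residue_points_def by (subst sum_Legendre_eq) simp_all
  ultimately have "(\<Sum>x\<in>{0..<int p}. Legendre (poly f x) (int p)) \<le>
      2 * int (card (residue_points p f)) + int d - int p" by linarith
  hence "real_of_int (\<Sum>x\<in>{0..<int p}. Legendre (poly f x) (int p)) \<le>
      real_of_int (2 * int (card (residue_points p f)) + int d - int p)"
        by (simp only: of_int_le_iff)
  also have "\<dots> = 2 * real (card (residue_points p f)) + real d - real p" by simp
  also have "\<dots> \<le> 2 * (p / 2 + 13 * real d * sqrt p) + real d - real p"
    using card_residue_points_le[OF p f f1 f0 deg d] by simp
  also have "\<dots> \<le> 26 * real d * sqrt p + real d * sqrt p"
    using prime_ge_1_nat[OF p(1)] by (simp add: mult_le_cancel_left1)
  finally show ?thesis by simp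
qed

lemma degree_smult_prod_linear_le:
  assumes "finite T"
  shows "degree (smult g (\<Prod>i\<in>T. [:f i, 1:])) \<le> card T"
proof -
  have "degree (\<Prod>i\<in>T. [:f i, 1:]) \<le> (\<Sum>i\<in>T. degree [:f i, 1:])"
    using degree_prod_sum_le[OF assms, of "\<lambda>i. [:f i, 1:]"] by (simp only: comp_def)
  thus ?thesis using degree_smult_le[of g "\<Prod>i\<in>T. [:f i, 1:]"] by simp
qed

lemma sum_Legendre_prod_shifts_le:
  assumes p: "prime p" "odd p" and T: "T \<subseteq> {1..k}" "T \<noteq> {}" and k: "k < p" and g: "\<not> int p dvd g"
  shows "(\<Sum>x\<in>{0..<int p}. Legendre (g * (\<Prod>i\<in>T. x + int i)) (int p)) \<le> 27 * real k * sqrt p"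
proof -
  have finT: "finite T" using T(1) finite_subset by blast
  obtain i0 where i0: "i0 \<in> T" using T(2) by blast
  define f1 where "f1 = smult g (\<Prod>i\<in>T - {i0}. [:int i, 1:])"
  define f where "f = [:- (- int i0), 1:] * f1"
  have f_prod: "f = smult g (\<Prod>i\<in>T. [:int i, 1:])"
    using prod.remove[OF finT i0, of "\<lambda>i. [:int i, 1:]"] unfolding f_def f1_def
    by (simp only: mult_smult_right minus_minus)
  have poly_f: "poly f x = g * (\<Prod>i\<in>T. x + int i)" for x
    unfolding f_prod by (simp add: poly_prod add.commute)
  have residue: "int i \<in> {0..<int p}" "int i \<noteq> 0" if "i \<in> T" for i
    using that T(1) k by auto
  have deg: "degree f \<le> k"
    using degree_smult_prod_linear_le[OF finT, of g int] card_mono[OF _ T(1)] unfolding f_prod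
    by simp
  have f0: "\<not> int p dvd coeff f 0"
  proof -
    have "coeff f 0 = g * (\<Prod>i\<in>T. int i)"
      using poly_f[of 0] by (simp add: poly_0_coeff_0)
    moreover have "\<not> int p dvd int i" if "i \<in> T" for i
      using not_dvd_diff_residues[of 0 "int p" "int i"] residue[OF that] by auto
    ultimately show ?thesis using g p(1) finT by (auto simp: prime_dvd_mult_iff prime_dvd_prod_iff)
  qed
  have f1: "\<not> int p dvd poly f1 (- int i0)"
  proof -
    have "poly f1 (- int i0) = g * (\<Prod>i\<in>T - {i0}. int i - int i0)"
      by (simp add: f1_def poly_prod)
    moreover have "\<not> int p dvd int i - int i0" if "i \<in> T - {i0}" for i
      using that i0 residue by (intro not_dvd_diff_residues) auto
    ultimately show ?thesis using g p(1) finT by (auto simp: prime_dvd_mult_iff prime_dvd_prod_iff)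
  qed
  have "k \<ge> 1" using T by auto
  with deg have "(\<Sum>x\<in>{0..<int p}. Legendre (poly f x) (int p)) \<le> 27 * real k * sqrt p"
    by (rule sum_Legendre_poly_le[OF p f_def f1 f0])
  thus ?thesis by (simp only: poly_f)
qed

definition Legendre_runs :: "nat \<Rightarrow> nat \<Rightarrow> int \<Rightarrow> int set" where
  "Legendre_runs p k \<eta> = {x \<in> {0..<int p}. \<forall>u\<in>{1..k}. Legendre (x + int u) (int p) = \<eta>}"

lemma one_plus_Legendre_nonneg: "\<eta> \<in> {1, -1} \<Longrightarrow> 0 \<le> 1 + \<eta> * Legendre a p"
  using Legendre_range[of a p] by auto

lemma prod_one_plus_Legendre:
  assumes p: "prime p" "2 < p" and U: "finite U"
  shows "(\<Prod>u\<in>U. 1 + Legendre g (int p) * Legendre (f u) (int p)) =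
    (\<Sum>T\<in>Pow U. Legendre (g ^ card T * (\<Prod>i\<in>T. f i)) (int p))"
proof -
  have "(\<Prod>u\<in>U. 1 + Legendre g (int p) * Legendre (f u) (int p)) =
      (\<Sum>T\<in>Pow U. \<Prod>i\<in>T. Legendre (g * f i) (int p))"
    using prod_add[OF U, of _ "\<lambda>_. 1"] by (simp add: Legendre_mult[OF p] add.commute)
  also have "\<dots> = (\<Sum>T\<in>Pow U. Legendre (\<Prod>i\<in>T. g * f i) (int p))"
    by (simp only: Legendre_prod[OF p])
  finally show ?thesis by (simp add: prod.distrib)
qed

text \<open>The product over \<open>u \<le> k\<close> of \<open>1 + \<eta> Legendre (x + u) p\<close> is nonnegative, and \<open>2\<^sup>k\<close> on runs.\<close>

lemma card_Legendre_runs_le: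
  assumes p: "prime p" "2 < p" and k: "1 \<le> k" "k < p" and \<eta>: "\<eta> \<in> {1, -1}"
  shows "card (Legendre_runs p k \<eta>) \<le> p / 2 ^ k + 27 * real k * sqrt p"
proof (cases "Legendre_runs p k \<eta> = {}")
  case False
  let ?E = "27 * real k * sqrt p" and ?U = "{1..k}"
  obtain g where g: "Legendre g (int p) = \<eta>" using False k unfolding Legendre_runs_def by force
  define P where "P = (\<lambda>x. \<Prod>u\<in>?U. 1 + \<eta> * Legendre (x + int u) (int p))"
  have P_nonneg: "P x \<ge> 0" for x
    unfolding P_def using \<eta> by (intro prod_nonneg one_plus_Legendre_nonneg)
  define corr where "corr = (\<lambda>T. \<Sum>x\<in>{0..<int p}. Legendre (g ^ card T * (\<Prod>i\<in>T. x + int i)) (int p))"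
  have "P x = 2 ^ k" if "x \<in> Legendre_runs p k \<eta>" for x
    using that \<eta> by (auto simp: P_def Legendre_runs_def)
  hence "2 ^ k * int (card (Legendre_runs p k \<eta>)) = sum P (Legendre_runs p k \<eta>)" by simp
  also have "\<dots> \<le> sum P {0..<int p}"
    by (intro sum_mono2) (auto simp: Legendre_runs_def P_nonneg)
  also have "\<dots> = (\<Sum>T\<in>Pow ?U. corr T)"
    unfolding P_def corr_def g[symmetric]
    by (simp only: prod_one_plus_Legendre[OF p finite_atLeastAtMost] sum.swap[of _ _ "Pow ?U"])
  also have "\<dots> = int p + (\<Sum>T\<in>Pow ?U - {{}}. corr T)"
    using p(2) by (subst sum.remove[of _ "{}"]) (auto simp: corr_def Legendre_1)
  finally have "real_of_int (2 ^ k * int (card (Legendre_runs p k \<eta>))) \<le>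
      real_of_int (int p + (\<Sum>T\<in>Pow ?U - {{}}. corr T))" by (simp only: of_int_le_iff)
  also have "\<dots> = p + (\<Sum>T\<in>Pow ?U - {{}}. real_of_int (corr T))" by simp
  also have "\<dots> \<le> p + (\<Sum>T\<in>Pow ?U - {{}}. ?E)"
  proof (intro add_left_mono sum_mono)
    fix T assume T: "T \<in> Pow ?U - {{}}"
    have "Legendre g (int p) \<noteq> 0" using g \<eta> by auto
    hence "\<not> int p dvd g ^ card T"
      using p(1) prime_dvd_power[of "int p" g] by (auto simp: Legendre_eq_0_iff)
    thus "real_of_int (corr T) \<le> ?E"
      unfolding corr_def using T p k prime_odd_nat[OF p]
      by (intro sum_Legendre_prod_shifts_le) auto
  qed
  also have "\<dots> \<le> p + (\<Sum>T\<in>Pow ?U. ?E)"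
    by (intro add_left_mono sum_mono2) auto
  finally show ?thesis by (simp add: card_Pow field_simps)
qed simp

subsection \<open>Divisors and primes\<close>

lemma card_divisors_mult_le:
  fixes a b :: nat
  assumes "a > 0" "b > 0"
  shows "card {d. d dvd a * b} \<le> card {d. d dvd a} * card {d. d dvd b}"
proof -
  have "{d. d dvd a * b} \<subseteq> (\<lambda>(x, y). x * y) ` ({d. d dvd a} \<times> {d. d dvd b})"
    by (force dest: division_decomp)
  moreover have "finite ({d. d dvd a} \<times> {d. d dvd b})" using assms by simp
  ultimately have "card {d. d dvd a * b} \<le> card ({d. d dvd a} \<times> {d. d dvd b})"
    by (meson surj_card_le)
  thus ?thesis by (simp add: card_cartesian_product)
qed

lemma card_divisors_prime_power_le:
  assumes "prime (q::nat)"
  shows "card {d. d dvd q ^ e} \<le> e + 1"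
proof -
  have "{d. d dvd q ^ e} = (\<lambda>i. q ^ i) ` {..e}"
    using divides_primepow_nat[OF assms] by auto
  thus ?thesis using card_image_le[of "{..e}" "\<lambda>i. q ^ i"] by simp
qed

lemma card_divisors_le_prod_multiplicity:
  fixes n :: nat
  assumes "n > 0"
  shows "card {d. d dvd n} \<le> (\<Prod>q\<in>prime_factors n. multiplicity q n + 1)"
proof -
  have "card {d. d dvd (\<Prod>q\<in>A. q ^ e q)} \<le> (\<Prod>q\<in>A. e q + 1)"
    if "finite A" "\<And>q. q \<in> A \<Longrightarrow> prime q" for A :: "nat set" and e
    using that
  proof (induction A rule: finite_induct)
    case (insert q A)
    have pos: "r ^ e r > 0" if "r \<in> insert q A" for r
      using insert.prems[OF that] by (simp add: prime_gt_0_nat)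
    have "card {d. d dvd q ^ e q * (\<Prod>q\<in>A. q ^ e q)} \<le>
        card {d. d dvd q ^ e q} * card {d. d dvd (\<Prod>q\<in>A. q ^ e q)}"
      using pos by (intro card_divisors_mult_le prod_pos) blast+
    also have "\<dots> \<le> (e q + 1) * (\<Prod>q\<in>A. e q + 1)"
      using insert by (intro mult_le_mono card_divisors_prime_power_le insert.IH) auto
    finally show ?case using insert.hyps by simp
  qed simp
  from this[of "prime_factors n" "\<lambda>q. multiplicity q n"] show ?thesis
    using prod_prime_factors[of n] assms by auto
qed

lemma exponent_le_powr:
  fixes \<delta> :: real
  assumes "\<delta> > 0"
  shows "\<exists>K\<ge>1. \<exists>Q. \<forall>q\<ge>2. \<forall>e. real e + 1 \<le> (if q < Q then K else 1) * (real q ^ e) powr \<delta>"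
proof -
  define K where "K = max 1 (1 / (\<delta> * ln 2))"
  define Q where "Q = nat \<lceil>2 powr (1 / \<delta>)\<rceil>"
  have K: "K \<ge> 1" by (simp add: K_def)
  have small: "real e + 1 \<le> K * (real q ^ e) powr \<delta>" if "q \<ge> 2" for q e :: nat
  proof -
    have "1 / (\<delta> * ln 2) * (\<delta> * ln 2) \<le> K * (\<delta> * ln 2)"
      using assms by (intro mult_right_mono) (auto simp: K_def)
    hence "1 \<le> K * (\<delta> * ln 2)" using assms by simp
    from mult_right_mono[OF this, of "real e"]
    have "real e + 1 \<le> K * (1 + real e * \<delta> * ln 2)" using K by (simp add: algebra_simps)
    also have "\<dots> \<le> K * exp (real e * \<delta> * ln 2)"
      using K by (intro mult_left_mono exp_ge_add_one_self) auto
    also have "exp (real e * \<delta> * ln 2) = (2 ^ e) powr \<delta>"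
      by (simp add: powr_def ln_realpow algebra_simps)
    also have "\<dots> \<le> (real q ^ e) powr \<delta>"
      using that assms by (intro powr_mono2 power_mono) auto
    finally show ?thesis using K by (simp add: mult_left_mono)
  qed
  have large: "real e + 1 \<le> (real q ^ e) powr \<delta>" if "q \<ge> Q" for q e :: nat
  proof -
    have q: "2 powr (1 / \<delta>) \<le> real q" using that unfolding Q_def by linarith
    hence "(2 powr (1 / \<delta>)) powr \<delta> \<le> real q powr \<delta>" using assms by (intro powr_mono2) auto
    hence "2 \<le> real q powr \<delta>" using assms by (simp add: powr_powr)
    have "real e + 1 \<le> 2 ^ e"
      using of_nat_le_iff[of "e + 1" "2 ^ e", where 'a = real] less_exp[of e] by simp
    also have "\<dots> \<le> (real q powr \<delta>) ^ e" using \<open>2 \<le> real q powr \<delta>\<close> by (intro power_mono) auto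
    also have "\<dots> = (real q ^ e) powr \<delta>"
      using less_le_trans[OF _ q, of 0]
      by (simp add: powr_realpow[symmetric] powr_powr mult.commute)
    finally show ?thesis .
  qed
  show ?thesis using K small large by (intro exI[of _ K] conjI exI[of _ Q]) auto
qed

lemma divisor_bound:
  fixes \<delta> :: real
  assumes "\<delta> > 0"
  shows "\<exists>C>0. \<forall>n::nat. n > 0 \<longrightarrow> real (card {d. d dvd n}) \<le> C * real n powr \<delta>"
proof -
  obtain K Q where K: "K \<ge> 1" and exponent:
      "\<And>q e. q \<ge> 2 \<Longrightarrow> real e + 1 \<le> (if q < Q then K else 1) * (real q ^ e) powr \<delta>"
    using exponent_le_powr[OF assms] by blast
  have "real (card {d. d dvd n}) \<le> K ^ Q * real n powr \<delta>" if "n > 0" for n :: nat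
  proof -
    let ?P = "prime_factors n" and ?e = "\<lambda>q. multiplicity q n"
    have "real (card {d. d dvd n}) \<le> (\<Prod>q\<in>?P. real (?e q) + 1)"
      using of_nat_mono[OF card_divisors_le_prod_multiplicity[OF that], where 'a = real]
      by (simp add: add.commute)
    also have "\<dots> \<le> (\<Prod>q\<in>?P. (if q < Q then K else 1) * (real q ^ ?e q) powr \<delta>)"
      by (intro prod_mono conjI exponent) (auto intro: prime_ge_2_nat)
    also have "\<dots> = (\<Prod>q\<in>?P. if q < Q then K else 1) * (\<Prod>q\<in>?P. (real q ^ ?e q) powr \<delta>)"
      by (rule prod.distrib)
    also have "(\<Prod>q\<in>?P. (real q ^ ?e q) powr \<delta>) = (\<Prod>q\<in>?P. real q ^ ?e q) powr \<delta>"
      by (rule prod_powr_distrib[symmetric])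
    also have "(\<Prod>q\<in>?P. real q ^ ?e q) = real n"
      using prod_prime_factors[of n] that by (simp flip: of_nat_power of_nat_prod)
    also have "(\<Prod>q\<in>?P. if q < Q then K else 1) = K ^ card (?P \<inter> {..<Q})"
      by (simp add: prod.If_cases lessThan_def)
    also have "\<dots> \<le> K ^ Q"
      using K card_mono[of "{..<Q}" "?P \<inter> {..<Q}"] by (intro power_increasing) auto
    finally show ?thesis by (simp add: mult_right_mono)
  qed
  moreover have "K ^ Q > 0" using K by simp
  ultimately show ?thesis by blast
qed

lemma divisor_bound_mono:
  fixes \<delta> :: real
  assumes "\<delta> > 0"
  shows "\<exists>C>0. \<forall>m n::nat. 0 < m \<longrightarrow> m \<le> n \<longrightarrow> real (card {d. d dvd m}) \<le> C * real n powr \<delta>"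
proof -
  obtain C where C: "C > 0" "\<And>m::nat. m > 0 \<Longrightarrow> real (card {d. d dvd m}) \<le> C * real m powr \<delta>"
    using divisor_bound[OF assms] by blast
  have "real (card {d. d dvd m}) \<le> C * real n powr \<delta>" if "0 < m" "m \<le> n" for m n :: nat
    using C(1) assms that by (intro order_trans[OF C(2)] mult_left_mono powr_mono2) auto
  with C(1) show ?thesis by blast
qed

text \<open>\<open>a! b! / (a + b + 1)!\<close> is the integral of \<open>x\<^sup>a (1 - x)\<^sup>b\<close> over the unit interval, hence an
  integer combination of the fractions \<open>1/1, \<dots>, 1/(a + b + 1)\<close>.\<close>

lemma Lcm_times_inverse_beta_Ints:
  assumes "a + b + 1 \<le> N"
  shows "real (Lcm {1..N}) * (fact a * fact b / fact (a + b + 1)) \<in> \<int>"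
  using assms
proof (induction b arbitrary: a)
  case 0
  have "a + 1 dvd Lcm {1..N}" using 0 by (intro dvd_Lcm) auto
  then obtain k where k: "Lcm {1..N} = (a + 1) * k" by (elim dvdE)
  have "real (Lcm {1..N}) * (fact a * fact 0 / fact (a + 0 + 1)) = real k"
    unfolding k by (simp add: divide_simps) (simp add: algebra_simps)
  thus ?case by simp
next
  case (Suc b)
  have "fact a * fact (Suc b) / (fact (a + Suc b + 1) :: real) =
      fact a * fact b / fact (a + b + 1) - fact (a + 1) * fact b / fact (a + 1 + b + 1)"
    by (simp add: divide_simps add_nonneg_eq_0_iff) (simp add: algebra_simps)
  thus ?case
    using Suc.IH[of a] Suc.IH[of "a + 1"] Suc.prems by (simp add: right_diff_distrib)
qed

lemma four_power_le_Lcm: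
  assumes "n > 0"
  shows "4 ^ n \<le> Lcm {1..2 * n + 1}"
proof -
  let ?M = "Lcm {1..2 * n + 1}" and ?c = "(2 * n + 1) * real ((2 * n) choose n)"
  have "?M > 0" by (intro Nat.gr0I) (simp add: Lcm_0_iff)
  have "fact n * fact n / fact (n + n + 1) = 1 / ?c"
  proof -
    have "real ((2 * n) choose n) = fact (2 * n) / (fact n * fact n)"
      using binomial_fact[of n "2 * n", where 'a = real] by simp
    moreover have "(fact (n + n + 1) :: real) = real (2 * n + 1) * fact (2 * n)"
      by (simp flip: mult_2)
    ultimately show ?thesis by simp
  qed
  hence "real ?M * (1 / ?c) \<in> \<int>"
    using Lcm_times_inverse_beta_Ints[of n n "2 * n + 1"] by simp
  moreover have "real ?M * (1 / ?c) > 0" using \<open>?M > 0\<close> by simp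
  ultimately have "1 \<le> real ?M * (1 / ?c)"
    using Ints_nonzero_abs_ge1[of "real ?M * (1 / ?c)"] by linarith
  hence "?c \<le> ?M" by (simp add: pos_le_divide_eq)
  moreover have "real (4 ^ n) \<le> 2 * n * real ((2 * n) choose n)"
    using central_binomial_lower_bound[OF \<open>n > 0\<close>] \<open>n > 0\<close> by (simp add: field_simps)
  hence "real (4 ^ n) \<le> ?c" by (simp add: algebra_simps)
  ultimately have "real (4 ^ n) \<le> real ?M" by linarith
  thus ?thesis by (simp only: of_nat_le_iff)
qed

lemma prime_power_dvd_Lcm:
  fixes A :: "nat set"
  assumes "prime q" "e > 0" "finite A" "0 \<notin> A" "q ^ e dvd Lcm A"
  shows "\<exists>x\<in>A. q ^ e dvd x"
  using assms(3-)
proof (induction A rule: finite_induct)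
  case empty
  thus ?case using assms(1,2) by simp
next
  case (insert x A)
  have nonzero: "x \<noteq> 0" "Lcm A \<noteq> 0" using insert by (auto simp: Lcm_0_iff)
  have "\<not> is_unit q" using assms(1) by auto
  hence "e \<le> multiplicity q (lcm x (Lcm A))"
    using insert.prems nonzero by (simp add: power_dvd_iff_le_multiplicity)
  hence "q ^ e dvd x \<or> q ^ e dvd Lcm A"
    using nonzero \<open>\<not> is_unit q\<close> assms(1)
    by (auto simp: multiplicity_lcm power_dvd_iff_le_multiplicity le_max_iff_disj)
  thus ?case using insert by blast
qed

lemma Lcm_le_power_card_primes:
  fixes N :: nat
  assumes "N > 0"
  shows "Lcm {1..N} \<le> N ^ card {q. prime q \<and> q \<le> N}"
proof -
  let ?L = "Lcm {1..N}" and ?P = "{q. prime q \<and> q \<le> N}"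
  have prime_power: "q ^ e \<le> N" if "prime q" "e > 0" "q ^ e dvd ?L" for q e :: nat
    using prime_power_dvd_Lcm[of q e "{1..N}"] that by (auto dest!: dvd_imp_le)
  have "?L \<noteq> 0" by (simp add: Lcm_0_iff)
  hence "?L = (\<Prod>q\<in>prime_factors ?L. q ^ multiplicity q ?L)"
    using prod_prime_factors[of ?L] by simp
  also have "\<dots> \<le> (\<Prod>q\<in>prime_factors ?L. N)"
    using \<open>?L \<noteq> 0\<close>
    by (intro prod_mono conjI prime_power multiplicity_dvd)
      (auto simp: prime_factors_multiplicity)
  also have "\<dots> = N ^ card (prime_factors ?L)" by simp
  also have "\<dots> \<le> N ^ card ?P"
    using assms prime_power[of _ 1]
    by (intro power_increasing card_mono) (auto simp: prime_factors_dvd)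
  finally show ?thesis .
qed

lemma card_primes_ge:
  fixes z :: real
  assumes "z \<ge> 4"
  shows "z / (8 * ln z) \<le> card {q::nat. prime q \<and> q \<le> z}"
proof -
  define x where "x = (z - 1) / 2"
  define n where "n = nat \<lfloor>x\<rfloor>"
  define N where "N = 2 * n + 1"
  have "x > 0" using assms by (simp add: x_def)
  hence "x - 1 < n" "n \<le> x" unfolding n_def by linarith+
  hence n: "z / 8 \<le> n" "N \<le> z" using assms by (auto simp: N_def x_def field_simps)
  hence "n > 0" using assms by linarith
  let ?\<pi> = "card {q. prime q \<and> q \<le> N}"
  have "4 ^ n \<le> N ^ ?\<pi>"
    using four_power_le_Lcm[OF \<open>n > 0\<close>] Lcm_le_power_card_primes[of N] unfolding N_def by simp
  hence "real (4 ^ n) \<le> real (N ^ ?\<pi>)" by (simp only: of_nat_le_iff)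
  hence "ln (4 ^ n) \<le> ln (real N ^ ?\<pi>)" by (subst ln_le_cancel_iff) (auto simp: N_def)
  hence "n * ln 4 \<le> ?\<pi> * ln N" by (simp add: ln_realpow N_def)
  moreover have "real n * 1 \<le> n * ln 4"
    using exp_le by (intro mult_left_mono) (auto simp: ln_ge_iff)
  moreover have "?\<pi> * ln N \<le> ?\<pi> * ln z" using n by (intro mult_left_mono) (auto simp: N_def)
  ultimately have "z / 8 \<le> ?\<pi> * ln z" using n(1) by linarith
  hence "z / (8 * ln z) \<le> ?\<pi>" using assms by (simp add: field_simps)
  moreover have "finite {q::nat. prime q \<and> q \<le> z}"
    by (rule finite_subset[of _ "{..nat \<lfloor>z\<rfloor>}"]) (auto simp: le_nat_floor)
  hence "?\<pi> \<le> card {q::nat. prime q \<and> q \<le> z}" using n(2) by (intro card_mono) auto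
  ultimately show ?thesis by linarith
qed

lemma card_large_prime_divisors_less:
  fixes m :: int and B :: nat
  assumes A: "finite A" "\<And>q. q \<in> A \<Longrightarrow> prime q \<and> q \<ge> B \<and> int q dvd m"
    and "B > 0" "m \<noteq> 0" "\<bar>m\<bar> < int B ^ j"
  shows "card A < j"
proof -
  have "coprime q r" if "q \<in> A" "r \<in> A" "q \<noteq> r" for q r
    using A(2) that by (intro primes_coprime) auto
  hence "Lcm A = \<Prod>A" using A(1) Lcm_coprime[of A] by (cases "A = {}") auto
  moreover have "Lcm A dvd nat \<bar>m\<bar>"
    using A(2) by (intro Lcm_least) (auto simp: dvd_nat_abs_iff)
  ultimately have "\<Prod>A \<le> nat \<bar>m\<bar>" using \<open>m \<noteq> 0\<close> by (simp add: dvd_imp_le)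
  moreover have "(\<Prod>q\<in>A. B) \<le> \<Prod>A" using A(2) by (intro prod_mono) auto
  ultimately have "B ^ card A \<le> nat \<bar>m\<bar>" by simp
  hence "int B ^ card A \<le> \<bar>m\<bar>" using \<open>m \<noteq> 0\<close> by (simp add: le_nat_iff)
  hence "int B ^ card A < int B ^ j" using assms(5) by simp
  thus ?thesis using \<open>B > 0\<close> power_increasing[of j "card A" "int B"] by fastforce
qed

lemma exists_residue_mult_cong:
  fixes a m :: int
  assumes "coprime a m" "m > 0"
  shows "\<exists>x\<in>{0..<m}. [a * x = s] (mod m)"
proof -
  obtain u where u: "[a * u = 1] (mod m)" using cong_solve_coprime_int[OF assms(1)] by blast
  have "[a * (u * s mod m) = a * u * s] (mod m)"
    unfolding mult.assoc by (intro cong_mult cong_refl) (simp add: cong_def)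
  also have "[a * u * s = 1 * s] (mod m)" by (intro cong_mult cong_refl u)
  finally have "[a * (u * s mod m) = s] (mod m)" by simp
  moreover have "u * s mod m \<in> {0..<m}" using assms(2) by simp
  ultimately show ?thesis by blast
qed

lemma prime_cross_products_neq:
  fixes v v' u u' :: nat
  assumes "prime v" "prime v'" "prime u" "v \<noteq> v'" "(v, v') \<noteq> (u, u')"
  shows "u * v' \<noteq> v * u'"
proof
  assume eq: "u * v' = v * u'"
  hence "v dvd u * v'" by simp
  hence "v = u" using assms by (auto simp: prime_dvd_mult_iff dest: primes_dvd_imp_eq)
  moreover from this eq have "v' = u'" using prime_gt_0_nat[OF assms(1)] by simp
  ultimately show False using assms(5) by simp
qed

lemma card_square_le_card_image_mult_energy:
  assumes "finite A"
  shows "(card A)\<^sup>2 \<le> card (f ` A) * card {(a, b) \<in> A \<times> A. f a = f b}"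
proof -
  define fibre where "fibre = (\<lambda>y. {a \<in> A. f a = y})"
  have fin: "finite (fibre y)" for y using assms by (simp add: fibre_def)
  have "card A = card (\<Union>y\<in>f ` A. fibre y)" by (rule arg_cong[of _ _ card]) (auto simp: fibre_def)
  also have "\<dots> = (\<Sum>y\<in>f ` A. card (fibre y))"
    using assms fin by (intro card_UN_disjoint) (auto simp: fibre_def)
  finally have card_A: "real (card A) = (\<Sum>y\<in>f ` A. real (card (fibre y)))" by simp
  have "card {(a, b) \<in> A \<times> A. f a = f b} = card (\<Union>y\<in>f ` A. fibre y \<times> fibre y)"
    by (rule arg_cong[of _ _ card]) (auto simp: fibre_def)
  also have "\<dots> = (\<Sum>y\<in>f ` A. card (fibre y \<times> fibre y))"
    using assms fin by (intro card_UN_disjoint) (auto simp: fibre_def)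
  finally have energy:
    "real (card {(a, b) \<in> A \<times> A. f a = f b}) = (\<Sum>y\<in>f ` A. (real (card (fibre y)))\<^sup>2)"
    by (simp add: card_cartesian_product power2_eq_square)
  have "real ((card A)\<^sup>2) \<le> real (card (f ` A) * card {(a, b) \<in> A \<times> A. f a = f b})"
    using sum_squared_le_sum_of_squares[of "\<lambda>y. real (card (fibre y))" "f ` A"] card_A energy
    by (simp add: mult.commute)
  thus ?thesis by (simp only: of_nat_le_iff)
qed

lemma exists_inj_on_subset_energy:
  assumes "finite A" and energy: "card {(a, b) \<in> A \<times> A. f a = f b} \<le> E"
  shows "\<exists>I\<subseteq>A. inj_on f I \<and> (card A)\<^sup>2 \<le> card I * E"
proof -
  obtain I where I: "I \<subseteq> A" "inj_on f I" "f ` A = f ` I"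
    using subset_image_inj[of "f ` A" f A] by auto
  have "(card A)\<^sup>2 \<le> card (f ` A) * card {(a, b) \<in> A \<times> A. f a = f b}"
    using assms(1) by (rule card_square_le_card_image_mult_energy)
  also have "\<dots> \<le> card I * E"
    unfolding I(3) card_image[OF I(2)] using energy by (rule mult_le_mono2)
  finally show ?thesis using I by blast
qed

lemma card_Sigma_le:
  assumes "finite K" "\<And>k. k \<in> K \<Longrightarrow> finite (A k)" "\<And>k. k \<in> K \<Longrightarrow> card (A k) \<le> T"
  shows "card (SIGMA k:K. A k) \<le> card K * T"
proof -
  have "card (SIGMA k:K. A k) = (\<Sum>k\<in>K. card (A k))" using assms(1,2) by (intro card_SigmaI) auto
  also have "\<dots> \<le> (\<Sum>k\<in>K. T)" using assms(3) by (intro sum_mono)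
  finally show ?thesis by simp
qed

subsection \<open>Distinct values of \<open>k - F(h)\<close> modulo a prime\<close>

locale cubic_mod =
  fixes p :: nat and A c :: int and N T :: nat
  assumes p: "prime p" and A: "\<not> int p dvd A" and N: "N > 0" "18 * N ^ 5 < p"
    and T: "\<And>m::nat. 0 < m \<Longrightarrow> m \<le> 3 * N ^ 5 \<Longrightarrow> card {d. d dvd m} \<le> T"
begin

definition F :: "int \<Rightarrow> int" where "F h = A * h ^ 3 + c * h"

definition grid :: "(int \<times> int) set" where "grid = {1..int N} \<times> {0..<int N}"

definition offset :: "int \<times> int \<Rightarrow> int" where "offset x = snd x - F (fst x)"

definition close_pairs :: "(int \<times> int) set" where
  "close_pairs = {(h, h'). 1 \<le> h \<and> h < h' \<and> h' \<le> int N \<and>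
    (\<exists>k. \<bar>k\<bar> < int N \<and> [F h' - F h = k] (mod int p))}"

definition gap :: "int \<times> int \<Rightarrow> int" where "gap x = snd x - fst x"

definition quad :: "int \<times> int \<Rightarrow> int" where "quad x = fst x ^ 2 + fst x * snd x + snd x ^ 2"

definition small_diff :: "int \<times> int \<Rightarrow> int" where
  "small_diff x = (SOME k. \<bar>k\<bar> < int N \<and> [F (snd x) - F (fst x) = k] (mod int p))"

lemma finite_grid [simp]: "finite grid"
  by (simp add: grid_def)

lemma card_grid: "card grid = N ^ 2"
  by (simp add: grid_def card_cartesian_product power2_eq_square)

lemma finite_close_pairs: "finite close_pairs"
  by (rule finite_subset[of _ "{1..int N} \<times> {1..int N}"]) (auto simp: close_pairs_def)

lemma coprime_p:
  assumes "\<not> int p dvd a"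
  shows "coprime a (int p)"
  using prime_imp_coprime[of "int p" a] p assms by (simp add: ac_simps)

lemma N_less_p: "int N < int p"
proof -
  have "N \<le> N ^ 5" using N(1) by (intro self_le_power) auto
  thus ?thesis using N(2) by linarith
qed

lemma F_diff: "F (snd x) - F (fst x) = gap x * (A * quad x + c)"
  by (simp add: F_def gap_def quad_def algebra_simps power2_eq_square power3_eq_cube)

lemma small_diff:
  assumes "x \<in> close_pairs"
  shows "\<bar>small_diff x\<bar> < int N" "[gap x * (A * quad x + c) = small_diff x] (mod int p)"
proof -
  have "\<exists>k. \<bar>k\<bar> < int N \<and> [F (snd x) - F (fst x) = k] (mod int p)"
    using assms by (auto simp: close_pairs_def)
  from someI_ex[OF this, folded small_diff_def]
  show "\<bar>small_diff x\<bar> < int N" "[gap x * (A * quad x + c) = small_diff x] (mod int p)"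
    by (simp_all only: F_diff)
qed

lemma gap_bounds:
  assumes "x \<in> close_pairs"
  shows "0 < gap x" "gap x < int N"
  using assms by (auto simp: gap_def close_pairs_def)

lemma quad_bounds:
  assumes "x \<in> close_pairs"
  shows "0 < quad x" "quad x \<le> 3 * int N ^ 2"
proof -
  obtain h h' where x: "x = (h, h')" "1 \<le> h" "h < h'" "h' \<le> int N"
    using assms by (auto simp: close_pairs_def)
  have "h ^ 2 \<le> int N ^ 2" "h' ^ 2 \<le> int N ^ 2" using x by (auto intro!: power_mono)
  moreover have "h * h' \<le> int N * int N" using x by (intro mult_mono) auto
  ultimately show "quad x \<le> 3 * int N ^ 2" by (simp add: x(1) quad_def power2_eq_square)
  have "0 < h ^ 2" "0 \<le> h * h'" "0 \<le> h' ^ 2" using x by auto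
  thus "0 < quad x" unfolding x(1) quad_def fst_conv snd_conv by linarith
qed

lemma close_pairs_abs_le:
  assumes "x \<in> close_pairs" "y \<in> close_pairs"
  shows "\<bar>gap x\<bar> \<le> int N" "\<bar>small_diff x\<bar> \<le> int N" "\<bar>quad x - quad y\<bar> \<le> 3 * int N ^ 2"
  using gap_bounds[OF assms(1)] small_diff(1)[OF assms(1)]
    quad_bounds[OF assms(1)] quad_bounds[OF assms(2)]
  by linarith+

lemma coprime_gap:
  assumes "x \<in> close_pairs"
  shows "coprime (gap x) (int p)"
  using gap_bounds[OF assms] N_less_p by (intro coprime_p zdvd_not_zless) auto

lemma quad_eq_if_cong:
  assumes "x \<in> close_pairs" "y \<in> close_pairs" and "[A * quad x + c = A * quad y + c] (mod int p)"
  shows "quad x = quad y"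
proof (rule cong_small_imp_eq)
  have "[A * quad x = A * quad y] (mod int p)" using assms(3) by (simp add: cong_add_rcancel)
  thus "[quad x = quad y] (mod int p)" using coprime_p[OF A] by (simp add: cong_mult_lcancel)
  have "3 * N ^ 2 \<le> 18 * N ^ 5" using N(1) power_increasing[of 2 5 N] by simp
  hence "int (3 * N ^ 2) < int p" using N(2) unfolding of_nat_less_iff by linarith
  thus "\<bar>quad x - quad y\<bar> < int p" using close_pairs_abs_le(3)[OF assms(1,2)] by simp
qed

lemma quad_eq_if_small_diff_eq:
  assumes x: "x \<in> close_pairs" and y: "y \<in> close_pairs" and "small_diff x = small_diff y"
    and "gap x = gap y"
  shows "quad x = quad y"
proof (rule quad_eq_if_cong[OF x y])
  have "[gap x * (A * quad x + c) = gap x * (A * quad y + c)] (mod int p)"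
    using small_diff(2)[OF x] small_diff(2)[OF y] assms(3,4) by (simp add: cong_def)
  thus "[A * quad x + c = A * quad y + c] (mod int p)"
    using coprime_gap[OF x] by (simp only: cong_mult_lcancel)
qed

lemma quad_eq_if_small_diff_0:
  assumes x: "x \<in> close_pairs" and y: "y \<in> close_pairs"
    and "small_diff x = 0" "small_diff y = 0"
  shows "quad x = quad y"
proof (rule quad_eq_if_cong[OF x y])
  have "[A * quad z + c = 0] (mod int p)" if "z \<in> close_pairs" "small_diff z = 0" for z
  proof -
    have "[gap z * (A * quad z + c) = gap z * 0] (mod int p)"
      using small_diff(2)[OF that(1)] that(2) by simp
    thus ?thesis using coprime_gap[OF that(1)] by (simp only: cong_mult_lcancel)
  qed
  from this[OF x assms(3)] this[OF y assms(4)] show "[A * quad x + c = A * quad y + c] (mod int p)"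
    by (simp add: cong_def)
qed

lemma close_pairs_eqI_fst:
  assumes "x \<in> close_pairs" "y \<in> close_pairs" "quad x = quad y" "fst x = fst y"
  shows "x = y"
proof -
  obtain h a b where xy: "x = (h, a)" "y = (h, b)" using assms(4) by (cases x; cases y) auto
  have pos: "h > 0" "a > 0" "b > 0" using assms(1,2) by (auto simp: xy close_pairs_def)
  have "quad x - quad y = (a - b) * (h + a + b)"
    by (simp add: xy quad_def algebra_simps power2_eq_square)
  hence "(a - b) * (h + a + b) = 0" using assms(3) by simp
  thus ?thesis using pos by (simp add: xy)
qed

lemma close_pairs_eqI_gap:
  assumes "x \<in> close_pairs" "y \<in> close_pairs" "quad x = quad y" "gap x = gap y"
  shows "x = y"
proof -
  define n where "n = gap x"
  define a where "a = fst x"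
  define b where "b = fst y"
  have xy: "x = (a, a + n)" "y = (b, b + n)"
    unfolding n_def using assms(4)[symmetric]
    by (auto simp: a_def b_def gap_def prod_eq_iff)
  have pos: "a > 0" "b > 0" "n > 0" using assms(1,2) by (auto simp: xy close_pairs_def)
  have "quad x - quad y = (a - b) * (3 * (a + b + n))"
    by (simp add: xy quad_def algebra_simps power2_eq_square)
  hence "(a - b) * (3 * (a + b + n)) = 0" using assms(3) by simp
  thus ?thesis using pos by (simp add: xy)
qed

lemma card_close_pairs_same_quad_le:
  assumes "B \<subseteq> close_pairs" "\<And>x y. x \<in> B \<Longrightarrow> y \<in> B \<Longrightarrow> quad x = quad y"
  shows "card B \<le> N"
proof -
  have "inj_on fst B" using assms close_pairs_eqI_fst by (meson inj_onI subsetD)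
  moreover have "fst ` B \<subseteq> {1..int N}" using assms(1) by (auto simp: close_pairs_def)
  ultimately have "card B \<le> card {1..int N}" by (intro card_inj_on_le) auto
  thus ?thesis by simp
qed

text \<open>The points \<open>(quad x, small_diff x / gap x)\<close> lie on a line modulo \<open>p\<close>, hence on a line over
  the rationals.\<close>

lemma gap_dvd:
  assumes x: "x \<in> close_pairs" and y: "y \<in> close_pairs" and z: "z \<in> close_pairs"
  shows "gap x dvd gap y * gap z * (quad y - quad z) * small_diff x"
proof -
  define L where "L = gap y * gap z * (quad y - quad z) * small_diff x"
  define M1 where "M1 = (quad x - quad z) * gap z * small_diff y"
  define M2 where "M2 = (quad y - quad x) * gap y * small_diff z"
  have "[L = gap y * gap z * (quad y - quad z) * (gap x * (A * quad x + c))] (mod int p)"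
    unfolding L_def by (intro cong_mult cong_refl cong_sym[OF small_diff(2)[OF x]])
  also have "gap y * gap z * (quad y - quad z) * (gap x * (A * quad x + c)) =
     gap x * ((quad x - quad z) * gap z * (gap y * (A * quad y + c)) +
              (quad y - quad x) * gap y * (gap z * (A * quad z + c)))"
    by (simp add: algebra_simps)
  also have "[\<dots> = gap x * (M1 + M2)] (mod int p)"
    unfolding M1_def M2_def
    by (intro cong_mult cong_add cong_refl small_diff(2)[OF y] small_diff(2)[OF z])
  finally have "[L = gap x * (M1 + M2)] (mod int p)" .
  moreover have "\<bar>L - gap x * (M1 + M2)\<bar> < int p"
  proof -
    have "\<bar>L\<bar> \<le> int N * int N * (3 * int N ^ 2) * int N"
      unfolding L_def abs_mult using x y z by (intro mult_mono close_pairs_abs_le) auto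
    moreover have "\<bar>M1\<bar> \<le> 3 * int N ^ 2 * int N * int N"
      unfolding M1_def abs_mult using x y z by (intro mult_mono close_pairs_abs_le) auto
    moreover have "\<bar>M2\<bar> \<le> 3 * int N ^ 2 * int N * int N"
      unfolding M2_def abs_mult using x y z by (intro mult_mono close_pairs_abs_le) auto
    ultimately have L: "\<bar>L\<bar> \<le> 3 * int N ^ 5" and M: "\<bar>M1 + M2\<bar> \<le> 6 * int N ^ 4"
      by (simp_all add: eval_nat_numeral)
    have "\<bar>gap x * (M1 + M2)\<bar> \<le> int N * (6 * int N ^ 4)"
      unfolding abs_mult using x M by (intro mult_mono close_pairs_abs_le) auto
    hence "\<bar>L - gap x * (M1 + M2)\<bar> \<le> int (18 * N ^ 5)" using L by (simp add: eval_nat_numeral)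
    also have "\<dots> < int p" using N(2) by (simp only: of_nat_less_iff)
    finally show ?thesis .
  qed
  ultimately have "L = gap x * (M1 + M2)" by (rule cong_small_imp_eq)
  thus ?thesis unfolding L_def by simp
qed

lemma inj_on_small_diff_gap: "inj_on (\<lambda>x. (small_diff x, nat (gap x))) close_pairs"
proof (rule inj_onI)
  fix x y
  assume x: "x \<in> close_pairs" and y: "y \<in> close_pairs"
    and "(small_diff x, nat (gap x)) = (small_diff y, nat (gap y))"
  hence same: "small_diff x = small_diff y" "gap x = gap y"
    using gap_bounds[OF x] gap_bounds[OF y] by auto
  hence "quad x = quad y" using x y by (intro quad_eq_if_small_diff_eq)
  thus "x = y" using same(2) close_pairs_eqI_gap[OF x y] by blast
qed

lemma card_close_pairs_small_diff_nonzero_le: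
  assumes \<alpha>: "\<alpha> \<noteq> 0" "\<bar>\<alpha>\<bar> \<le> 3 * int N ^ 4" "\<And>x. x \<in> close_pairs \<Longrightarrow> gap x dvd \<alpha> * small_diff x"
  shows "card {x \<in> close_pairs. small_diff x \<noteq> 0} \<le> 2 * N * T"
proof -
  define U where "U = {- int N<..<int N} - {0}"
  define D where "D = (\<lambda>k. {d. d dvd nat \<bar>\<alpha> * k\<bar>})"
  have finite_D: "finite (D k)" if "k \<in> U" for k
    using that \<alpha>(1) unfolding D_def by (intro finite_divisors_nat) (auto simp: U_def)
  have "card {x \<in> close_pairs. small_diff x \<noteq> 0} \<le> card (SIGMA k:U. D k)"
  proof (rule card_inj_on_le)
    show "inj_on (\<lambda>x. (small_diff x, nat (gap x))) {x \<in> close_pairs. small_diff x \<noteq> 0}"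
      using inj_on_small_diff_gap by (rule inj_on_subset) auto
    have "nat (gap x) \<in> D (small_diff x)" if "x \<in> close_pairs" for x
      using \<alpha>(3)[OF that] gap_bounds[OF that] by (simp add: D_def nat_dvd_iff)
    thus "(\<lambda>x. (small_diff x, nat (gap x))) ` {x \<in> close_pairs. small_diff x \<noteq> 0} \<subseteq> (SIGMA k:U. D k)"
      using small_diff(1) by (fastforce simp: U_def)
    show "finite (SIGMA k:U. D k)" using finite_D by (intro finite_SigmaI) (auto simp: U_def)
  qed
  also have "\<dots> \<le> card U * T"
  proof (rule card_Sigma_le[OF _ finite_D])
    fix k assume k: "k \<in> U"
    have "\<bar>\<alpha> * k\<bar> \<le> (3 * int N ^ 4) * int N"
      unfolding abs_mult using \<alpha>(2) k by (intro mult_mono) (auto simp: U_def)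
    also have "\<dots> = int (3 * N ^ 5)" by (simp add: eval_nat_numeral)
    finally have "nat \<bar>\<alpha> * k\<bar> \<le> 3 * N ^ 5" by linarith
    thus "card (D k) \<le> T" unfolding D_def using k \<alpha>(1) by (intro T) (auto simp: U_def)
  qed (auto simp: U_def)
  also have "card U \<le> 2 * N"
  proof -
    have "card U \<le> card {- int N<..<int N}" unfolding U_def by (intro card_mono) auto
    thus ?thesis using N by simp
  qed
  finally show ?thesis by simp
qed

lemma card_close_pairs_le:
  "card close_pairs \<le> N + 2 * N * T"
proof (cases "\<forall>x\<in>close_pairs. \<forall>y\<in>close_pairs. quad x = quad y")
  case True
  thus ?thesis using card_close_pairs_same_quad_le[of close_pairs] by fastforce
next
  case False
  then obtain y z where y: "y \<in> close_pairs" and z: "z \<in> close_pairs" and "quad y \<noteq> quad z" by blast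
  define \<alpha> where "\<alpha> = gap y * gap z * (quad y - quad z)"
  have "\<alpha> \<noteq> 0" using \<open>quad y \<noteq> quad z\<close> gap_bounds[OF y] gap_bounds[OF z] by (simp add: \<alpha>_def)
  moreover have "\<bar>\<alpha>\<bar> \<le> int N * int N * (3 * int N ^ 2)"
    unfolding \<alpha>_def abs_mult using y z by (intro mult_mono close_pairs_abs_le) auto
  hence "\<bar>\<alpha>\<bar> \<le> 3 * int N ^ 4" by (simp add: eval_nat_numeral)
  moreover have "gap x dvd \<alpha> * small_diff x" if "x \<in> close_pairs" for x
    unfolding \<alpha>_def using that y z by (rule gap_dvd)
  ultimately have "card {x \<in> close_pairs. small_diff x \<noteq> 0} \<le> 2 * N * T"
    using card_close_pairs_small_diff_nonzero_le by blast
  moreover have "card {x \<in> close_pairs. small_diff x = 0} \<le> N"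
    using quad_eq_if_small_diff_0 by (intro card_close_pairs_same_quad_le) auto
  moreover have "card close_pairs \<le>
      card {x \<in> close_pairs. small_diff x = 0} + card {x \<in> close_pairs. small_diff x \<noteq> 0}"
    by (rule order_trans[OF card_mono card_Un_le]) (auto simp: finite_close_pairs)
  ultimately show ?thesis by linarith
qed

definition grid_coincidences :: "((int \<times> int) \<times> (int \<times> int)) set" where
  "grid_coincidences = {(x, y) \<in> grid \<times> grid. offset x mod int p = offset y mod int p}"

lemma grid_coincidencesD:
  assumes "((h, k), (h', k')) \<in> grid_coincidences"
  shows "h \<in> {1..int N}" "h' \<in> {1..int N}" "k \<in> {0..<int N}" "k' \<in> {0..<int N}"
    "[F h' - F h = k' - k] (mod int p)"
proof -
  have "(h, k) \<in> grid" "(h', k') \<in> grid" using assms by (simp_all add: grid_coincidences_def)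
  thus "h \<in> {1..int N}" "h' \<in> {1..int N}" "k \<in> {0..<int N}" "k' \<in> {0..<int N}"
    by (simp_all add: grid_def)
  have "[k' - F h' = k - F h] (mod int p)"
    using assms by (simp add: grid_coincidences_def offset_def cong_def)
  hence "[(k' - F h') + (F h' - k) = (k - F h) + (F h' - k)] (mod int p)"
    by (intro cong_add cong_refl)
  thus "[F h' - F h = k' - k] (mod int p)" by (simp add: cong_sym_eq)
qed

lemma card_grid_coincidences_same_fst_le:
  "card {(x, y) \<in> grid_coincidences. fst x = fst y} \<le> N ^ 2"
proof -
  have "{(x, y) \<in> grid_coincidences. fst x = fst y} \<subseteq> (\<lambda>x. (x, x)) ` grid"
  proof clarsimp
    fix h k k' assume coincidence: "((h, k), (h, k')) \<in> grid_coincidences"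
    have "k' - k = 0"
    proof (rule cong_small_imp_eq)
      show "[k' - k = 0] (mod int p)"
        using grid_coincidencesD(5)[OF coincidence] by (simp add: cong_sym_eq)
      show "\<bar>k' - k - 0\<bar> < int p" using grid_coincidencesD(3,4)[OF coincidence] N_less_p by auto
    qed
    thus "((h, k), h, k') \<in> (\<lambda>x. (x, x)) ` grid"
      using coincidence by (auto simp: grid_coincidences_def)
  qed
  hence "card {(x, y) \<in> grid_coincidences. fst x = fst y} \<le> card grid"
    by (rule surj_card_le[rotated]) simp
  thus ?thesis by (simp add: card_grid)
qed

lemma card_grid_coincidences_fst_less_le:
  "card {(x, y) \<in> grid_coincidences. fst x < fst y} \<le> (N + 2 * N * T) * N"
proof -
  have "card {(x, y) \<in> grid_coincidences. fst x < fst y} \<le> card (close_pairs \<times> {0..<int N})"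
  proof (rule card_inj_on_le)
    show "inj_on (\<lambda>(x, y). ((fst x, fst y), snd x)) {(x, y) \<in> grid_coincidences. fst x < fst y}"
    proof (rule inj_onI, clarsimp)
      fix h k h' k1 k2
      assume coincidences:
        "((h, k), (h', k1)) \<in> grid_coincidences" "((h, k), (h', k2)) \<in> grid_coincidences"
      hence "[k1 - k = k2 - k] (mod int p)"
        using grid_coincidencesD(5) by (meson cong_sym cong_trans)
      moreover have "\<bar>(k1 - k) - (k2 - k)\<bar> < int p"
        using coincidences[THEN grid_coincidencesD(4)] N_less_p by auto
      ultimately show "k1 = k2" using cong_small_imp_eq by fastforce
    qed
    show "(\<lambda>(x, y). ((fst x, fst y), snd x)) ` {(x, y) \<in> grid_coincidences. fst x < fst y} \<subseteq>
        close_pairs \<times> {0..<int N}"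
    proof clarsimp
      fix h k h' k' assume coincidence: "((h, k), (h', k')) \<in> grid_coincidences" and "h < h'"
      note bounds = grid_coincidencesD[OF coincidence]
      moreover have "\<bar>k' - k\<bar> < int N" using bounds by auto
      ultimately show "(h, h') \<in> close_pairs \<and> 0 \<le> k \<and> k < int N"
        using \<open>h < h'\<close> by (auto simp: close_pairs_def)
    qed
  qed (auto simp: finite_close_pairs)
  also have "\<dots> \<le> (N + 2 * N * T) * N"
    using card_close_pairs_le by (simp add: card_cartesian_product)
  finally show ?thesis .
qed

lemma card_grid_coincidences_le:
  "card grid_coincidences \<le> N ^ 2 * (3 + 4 * T)"
proof -
  let ?same = "{(x, y) \<in> grid_coincidences. fst x = fst y}"
  let ?less = "{(x, y) \<in> grid_coincidences. fst x < fst y}"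
  let ?greater = "{(x, y) \<in> grid_coincidences. fst y < fst x}"
  have "bij_betw prod.swap ?greater ?less"
    by (rule bij_betwI[of _ _ _ prod.swap]) (auto simp: grid_coincidences_def)
  hence "card ?greater = card ?less" by (rule bij_betw_same_card)
  have "card grid_coincidences = card (?same \<union> (?less \<union> ?greater))"
    by (rule arg_cong[of _ _ card]) auto
  also have "\<dots> \<le> card ?same + (card ?less + card ?greater)"
    by (meson add_left_mono card_Un_le order_trans)
  also have "\<dots> \<le> N ^ 2 + ((N + 2 * N * T) * N + (N + 2 * N * T) * N)"
    unfolding \<open>card ?greater = card ?less\<close>
    by (intro add_mono card_grid_coincidences_same_fst_le card_grid_coincidences_fst_less_le)
  also have "\<dots> = N ^ 2 * (3 + 4 * T)" by (simp add: algebra_simps power2_eq_square)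
  finally show ?thesis .
qed

lemma exists_many_distinct_offsets:
  "\<exists>I\<subseteq>grid. inj_on (\<lambda>x. offset x mod int p) I \<and> N ^ 2 \<le> card I * (3 + 4 * T)"
proof -
  obtain I where I: "I \<subseteq> grid" "inj_on (\<lambda>x. offset x mod int p) I"
      and "(card grid)\<^sup>2 \<le> card I * (N ^ 2 * (3 + 4 * T))"
    using exists_inj_on_subset_energy[OF finite_grid, of "\<lambda>x. offset x mod int p"]
      card_grid_coincidences_le unfolding grid_coincidences_def by blast
  hence "N ^ 2 * N ^ 2 \<le> N ^ 2 * (card I * (3 + 4 * T))"
    by (simp add: card_grid power2_eq_square algebra_simps)
  hence "N ^ 2 \<le> card I * (3 + 4 * T)" using N(1) unfolding nat_mult_le_cancel_disj by simp
  thus ?thesis using I by blast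
qed




end

subsection \<open>Many quotients \<open>(k - F(h)) / v\<close> with \<open>v\<close> prime\<close>

context cubic_mod
begin

definition small_fraction :: "nat \<Rightarrow> int \<Rightarrow> int \<Rightarrow> int \<Rightarrow> bool" where
  "small_fraction V h d w \<longleftrightarrow>
    0 < d \<and> d \<le> int V ^ 2 \<and> \<bar>w\<bar> \<le> 2 * int N * int V ^ 2 \<and> [d * F h = w] (mod int p)"

lemma small_fraction_if_signed:
  assumes "\<Delta> \<noteq> 0" "\<bar>\<Delta>\<bar> \<le> int V ^ 2" "\<bar>w\<bar> \<le> 2 * int N * int V ^ 2" "[\<Delta> * F h = w] (mod int p)"
  shows "\<exists>d w. small_fraction V h d w"
proof (cases "\<Delta> > 0")
  case True
  thus ?thesis using assms by (auto simp: small_fraction_def)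
next
  case False
  have "[(- \<Delta>) * F h = - w] (mod int p)" using assms(4) cong_minus_minus_iff[of "\<Delta> * F h" w] by simp
  thus ?thesis using assms False
    by (intro exI[of _ "- \<Delta>"] exI[of _ "- w"]) (auto simp: small_fraction_def)
qed

text \<open>Cramer's rule for \<open>F h\<close>.\<close>

lemma small_fraction_if_two_relations:
  fixes v v' u u' :: nat
  assumes primes: "prime v" "prime v'" "prime u" and neq: "v \<noteq> v'" "(v, v') \<noteq> (u, u')"
    and V: "v \<le> V" "v' \<le> V" "u \<le> V" "u' \<le> V"
    and w: "\<bar>w1\<bar> \<le> int N * int V" "\<bar>w2\<bar> \<le> int N * int V"
    and rel: "[int v' * F h - int v * F h' = w1] (mod int p)"
      "[int u' * F h - int u * F h' = w2] (mod int p)"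
  shows "\<exists>d w. small_fraction V h d w"
proof (rule small_fraction_if_signed)
  let ?\<Delta> = "int u * int v' - int v * int u'"
  have "int (u * v') \<noteq> int (v * u')"
    unfolding of_nat_eq_iff using primes neq by (rule prime_cross_products_neq)
  thus "?\<Delta> \<noteq> 0" by simp
  have prod_le: "int a * int b \<le> int V ^ 2" if "a \<le> V" "b \<le> V" for a b
    using that unfolding power2_eq_square by (intro mult_mono) auto
  have "0 \<le> int u * int v'" "0 \<le> int v * int u'" by simp_all
  thus "\<bar>?\<Delta>\<bar> \<le> int V ^ 2" using prod_le[OF V(3,2)] prod_le[OF V(1,4)] by linarith
  have "[int u * (int v' * F h - int v * F h') - int v * (int u' * F h - int u * F h') =
      int u * w1 - int v * w2] (mod int p)"
    by (intro cong_diff cong_mult cong_refl rel)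
  thus "[?\<Delta> * F h = int u * w1 - int v * w2] (mod int p)" by (simp add: algebra_simps)
  have "\<bar>int u * w1\<bar> \<le> int V * (int N * int V)" "\<bar>int v * w2\<bar> \<le> int V * (int N * int V)"
    unfolding abs_mult using V w by (auto intro!: mult_mono)
  moreover have "int V * (int N * int V) = int N * int V ^ 2" by (simp add: power2_eq_square)
  ultimately show "\<bar>int u * w1 - int v * w2\<bar> \<le> 2 * int N * int V ^ 2" by linarith
qed

end

locale cubic_quotients = cubic_mod +
  fixes I :: "(int \<times> int) set" and P :: "nat set" and V0 V :: nat
  assumes I: "I \<subseteq> grid" "inj_on (\<lambda>x. offset x mod int p) I"
    and not_p_dvd_offset: "\<And>x. x \<in> I \<Longrightarrow> \<not> int p dvd offset x"
    and P: "\<And>v. v \<in> P \<Longrightarrow> prime v \<and> V0 \<le> v \<and> v \<le> V"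
    and V0: "0 < V0" and size: "6 * N * V ^ 5 < p" "3 * N * V ^ 2 < V0 ^ 5" "V ^ 2 < V0 ^ 3"
begin

definition has_small_fraction :: "int \<Rightarrow> bool" where
  "has_small_fraction h \<longleftrightarrow> (\<exists>d w. small_fraction V h d w)"

definition denom :: "int \<Rightarrow> int" where
  "denom h = fst (SOME dw. small_fraction V h (fst dw) (snd dw))"

definition numer :: "int \<Rightarrow> int" where
  "numer h = snd (SOME dw. small_fraction V h (fst dw) (snd dw))"

lemma small_fraction_denom_numer:
  assumes "has_small_fraction h"
  shows "small_fraction V h (denom h) (numer h)"
proof -
  have "\<exists>dw. small_fraction V h (fst dw) (snd dw)"
    using assms by (auto simp: has_small_fraction_def)
  from someI_ex[OF this] show ?thesis by (simp only: denom_def numer_def)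
qed

lemma denom_numer:
  assumes "has_small_fraction h"
  shows "0 < denom h" "denom h \<le> int V ^ 2" "\<bar>numer h\<bar> \<le> 2 * int N * int V ^ 2"
    "[denom h * F h = numer h] (mod int p)"
  using small_fraction_denom_numer[OF assms] by (auto simp: small_fraction_def)

definition scaled_offset :: "int \<times> int \<Rightarrow> int" where
  "scaled_offset x = denom (fst x) * snd x - numer (fst x)"

definition exceptional :: "int \<times> int \<Rightarrow> nat set" where
  "exceptional x = {v \<in> P. has_small_fraction (fst x) \<and> int v dvd scaled_offset x}"

definition admissible :: "((int \<times> int) \<times> nat) set" where
  "admissible = (SIGMA x:I. P - exceptional x)"

lemma finite_P: "finite P"
  by (rule finite_subset[of _ "{..V}"]) (use P in auto)

lemma finite_I: "finite I"
  using I(1) finite_grid finite_subset by blast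

lemma finite_admissible: "finite admissible"
  unfolding admissible_def using finite_I finite_P by auto

lemma monomial_less_p:
  assumes "v \<in> P" "i \<le> 1" "j \<le> 5"
  shows "6 * (int N ^ i * int V ^ j) < int p"
proof -
  have "V > 0" using P[OF assms(1)] V0 by simp
  hence "N ^ i * V ^ j \<le> N ^ 1 * V ^ 5"
    using assms(2,3) N by (intro mult_mono power_increasing) auto
  hence "6 * (N ^ i * V ^ j) < p" using size(1) by simp
  hence "int (6 * (N ^ i * V ^ j)) < int p" by (simp only: of_nat_less_iff)
  thus ?thesis by simp
qed

lemma coprime_P:
  assumes "v \<in> P"
  shows "coprime (int v) (int p)"
  using P[OF assms] prime_gt_0_nat[of v] monomial_less_p[OF assms, of 0 1]
  by (intro coprime_p zdvd_not_zless) auto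

lemma I_bounds:
  assumes "x \<in> I"
  shows "1 \<le> fst x" "fst x \<le> int N" "0 \<le> snd x" "snd x < int N"
  using assms I(1) by (auto simp: grid_def)

lemma abs_scaled_offset_le:
  assumes "x \<in> I" "has_small_fraction (fst x)"
  shows "\<bar>scaled_offset x\<bar> \<le> 3 * int N * int V ^ 2"
proof -
  have "denom (fst x) * snd x \<le> int V ^ 2 * int N"
    using denom_numer[OF assms(2)] I_bounds[OF assms(1)] by (intro mult_mono) auto
  moreover have "int V ^ 2 * int N = int N * int V ^ 2" by simp
  moreover have "0 \<le> denom (fst x) * snd x"
    using denom_numer(1)[OF assms(2)] I_bounds[OF assms(1)] by simp
  ultimately show ?thesis using denom_numer(3)[OF assms(2)] unfolding scaled_offset_def by linarith
qed

lemma scaled_offset_cong: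
  assumes "has_small_fraction (fst x)"
  shows "[denom (fst x) * offset x = scaled_offset x] (mod int p)"
proof -
  have "[denom (fst x) * snd x - denom (fst x) * F (fst x) = scaled_offset x] (mod int p)"
    unfolding scaled_offset_def by (intro cong_diff cong_refl denom_numer[OF assms])
  thus ?thesis by (simp add: offset_def right_diff_distrib)
qed

lemma scaled_offset_nonzero:
  assumes "x \<in> I" "has_small_fraction (fst x)" "v \<in> P"
  shows "scaled_offset x \<noteq> 0"
proof
  assume "scaled_offset x = 0"
  hence "int p dvd denom (fst x) * offset x"
    using scaled_offset_cong[OF assms(2)] by (simp add: cong_0_iff)
  hence "int p dvd denom (fst x)"
    using not_p_dvd_offset[OF assms(1)] p by (simp add: prime_dvd_mult_iff)
  moreover have "denom (fst x) < int p"
    using denom_numer(2)[OF assms(2)] monomial_less_p[OF assms(3), of 0 2] by simp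
  ultimately show False using denom_numer(1)[OF assms(2)] zdvd_not_zless by blast
qed

lemma card_exceptional_le:
  assumes "x \<in> I"
  shows "card (exceptional x) \<le> 4"
proof (cases "exceptional x = {}")
  case False
  then obtain v where v: "v \<in> P" "has_small_fraction (fst x)" by (auto simp: exceptional_def)
  have "card (exceptional x) < 5"
  proof (rule card_large_prime_divisors_less[OF _ _ V0])
    show "prime q \<and> V0 \<le> q \<and> int q dvd scaled_offset x" if "q \<in> exceptional x" for q
      using that P by (auto simp: exceptional_def)
    show "scaled_offset x \<noteq> 0" using assms v(2,1) by (rule scaled_offset_nonzero)
    have "\<bar>scaled_offset x\<bar> \<le> int (3 * N * V ^ 2)" using abs_scaled_offset_le[OF assms v(2)] by simp
    also have "\<dots> < int (V0 ^ 5)" using size(2) by (simp only: of_nat_less_iff)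
    finally show "\<bar>scaled_offset x\<bar> < int V0 ^ 5" by simp
  qed (use finite_P in \<open>simp add: exceptional_def\<close>)
  thus ?thesis by simp
qed simp

lemma card_admissible_ge: "card I * (card P - 4) \<le> card admissible"
proof -
  have "card admissible = (\<Sum>x\<in>I. card (P - exceptional x))"
    unfolding admissible_def using finite_I finite_P by (intro card_SigmaI) auto
  also have "\<dots> \<ge> (\<Sum>x\<in>I. card P - 4)"
  proof (rule sum_mono)
    fix x assume "x \<in> I"
    have "card (P - exceptional x) = card P - card (exceptional x)"
      using finite_P by (intro card_Diff_subset) (auto simp: exceptional_def)
    thus "card P - 4 \<le> card (P - exceptional x)" using card_exceptional_le[OF \<open>x \<in> I\<close>] by simp
  qed
  finally show ?thesis by simp
qed

lemma card_admissible_le: "card admissible \<le> card I * card P"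
  unfolding admissible_def using finite_I finite_P by (intro card_Sigma_le card_mono) auto

definition coincidences :: "(((int \<times> int) \<times> nat) \<times> ((int \<times> int) \<times> nat)) set" where
  "coincidences = {(a, b) \<in> admissible \<times> admissible.
    [int (snd b) * offset (fst a) = int (snd a) * offset (fst b)] (mod int p)}"

definition mixed_coincidences :: "(((int \<times> int) \<times> nat) \<times> ((int \<times> int) \<times> nat)) set" where
  "mixed_coincidences = {(a, b) \<in> coincidences. snd a \<noteq> snd b}"

definition mixed_primes :: "int \<times> int \<Rightarrow> (nat \<times> nat) set" where
  "mixed_primes = (\<lambda>(h, h'). {(v, v'). \<exists>k k'. (((h, k), v), ((h', k'), v')) \<in> mixed_coincidences})"

lemma mixed_coincidencesD:
  assumes "(((h, k), v), ((h', k'), v')) \<in> mixed_coincidences"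
  shows "(h, k) \<in> I" "(h', k') \<in> I" "v \<in> P" "v' \<in> P" "v \<noteq> v'"
    "v \<notin> exceptional (h, k)" "[int v' * offset (h, k) = int v * offset (h', k')] (mod int p)"
  using assms by (auto simp: mixed_coincidences_def coincidences_def admissible_def)

lemma mixed_coincidences_swap: "(a, b) \<in> mixed_coincidences \<Longrightarrow> (b, a) \<in> mixed_coincidences"
  by (auto simp: mixed_coincidences_def coincidences_def cong_sym)

lemma mixed_coincidences_relation:
  assumes "(((h, k), v), ((h', k'), v')) \<in> mixed_coincidences"
  shows "[int v' * F h - int v * F h' = int v' * k - int v * k'] (mod int p)"
    "\<bar>int v' * k - int v * k'\<bar> \<le> int N * int V"
proof -
  note mixed = mixed_coincidencesD[OF assms]
  have "int p dvd int v' * offset (h, k) - int v * offset (h', k')"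
    using mixed(7) by (simp only: cong_iff_dvd_diff)
  moreover have "int v' * F h - int v * F h' - (int v' * k - int v * k') =
      - (int v' * offset (h, k) - int v * offset (h', k'))" by (simp add: offset_def algebra_simps)
  ultimately show "[int v' * F h - int v * F h' = int v' * k - int v * k'] (mod int p)"
    by (simp only: cong_iff_dvd_diff dvd_minus_iff)
  have "int v' * k \<le> int V * int N" "int v * k' \<le> int V * int N"
    using I_bounds[OF mixed(1)] I_bounds[OF mixed(2)] P[OF mixed(3)] P[OF mixed(4)]
    by (auto intro!: mult_mono)
  moreover have "0 \<le> int v' * k" "0 \<le> int v * k'"
    using I_bounds[OF mixed(1)] I_bounds[OF mixed(2)] by auto
  ultimately show "\<bar>int v' * k - int v * k'\<bar> \<le> int N * int V" by (simp add: mult.commute)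
qed

lemma scaled_offset_eq:
  assumes mixed: "(((h, k), v), ((h', k'), v')) \<in> mixed_coincidences"
    and frac: "has_small_fraction h" "has_small_fraction h'"
  shows "int v' * denom h' * scaled_offset (h, k) = int v * denom h * scaled_offset (h', k')"
proof (rule cong_small_imp_eq)
  let ?x = "scaled_offset (h, k)" and ?y = "scaled_offset (h', k')"
  note mixedD = mixed_coincidencesD[OF mixed]
  have "[int v' * denom h' * ?x = int v' * denom h' * (denom h * offset (h, k))] (mod int p)"
    using scaled_offset_cong[of "(h, k)"] frac(1)
    by (intro cong_mult cong_refl) (simp add: cong_sym)
  also have "int v' * denom h' * (denom h * offset (h, k)) =
      denom h * denom h' * (int v' * offset (h, k))" by (simp add: mult_ac)
  also have "[\<dots> = denom h * denom h' * (int v * offset (h', k'))] (mod int p)"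
    by (intro cong_mult cong_refl mixedD(7))
  also have "denom h * denom h' * (int v * offset (h', k')) =
      int v * denom h * (denom h' * offset (h', k'))" by (simp add: mult_ac)
  also have "[\<dots> = int v * denom h * ?y] (mod int p)"
    using scaled_offset_cong[of "(h', k')"] frac(2) by (intro cong_mult cong_refl) simp
  finally show "[int v' * denom h' * ?x = int v * denom h * ?y] (mod int p)" .
  have bound: "\<bar>int u * denom l * scaled_offset x\<bar> \<le> 3 * (int N ^ 1 * int V ^ 5)"
    if "u \<in> P" "has_small_fraction l" "x \<in> I" "has_small_fraction (fst x)" for u l x
  proof -
    have "\<bar>int u * denom l * scaled_offset x\<bar> \<le> int V * int V ^ 2 * (3 * int N * int V ^ 2)"
      unfolding abs_mult
      using P[OF that(1)] denom_numer[OF that(2)] abs_scaled_offset_le[OF that(3,4)]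
      by (intro mult_mono) auto
    thus ?thesis by (simp add: eval_nat_numeral mult_ac)
  qed
  show "\<bar>int v' * denom h' * ?x - int v * denom h * ?y\<bar> < int p"
    using bound[OF mixedD(4) frac(2) mixedD(1)] bound[OF mixedD(3) frac(1) mixedD(2)] frac
      monomial_less_p[OF mixedD(3), of 1 5] by simp
qed

lemma prime_dvd_denom:
  assumes mixed: "(((h, k), v), ((h', k'), v')) \<in> mixed_coincidences"
    and frac: "has_small_fraction h" "has_small_fraction h'"
  shows "int v dvd denom h'"
proof -
  note mixedD = mixed_coincidencesD[OF mixed]
  have "int v dvd int v' * denom h' * scaled_offset (h, k)"
    unfolding scaled_offset_eq[OF mixed frac] by simp
  moreover have "\<not> int v dvd scaled_offset (h, k)"
    using mixedD(3,6) frac by (auto simp: exceptional_def)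
  moreover have "prime (int v)" "\<not> int v dvd int v'"
    using P[OF mixedD(3)] P[OF mixedD(4)] mixedD(5) by (auto dest: primes_dvd_imp_eq)
  ultimately show ?thesis by (auto simp: prime_dvd_mult_iff)
qed

lemma mixed_primes_subset: "mixed_primes hh \<subseteq> P \<times> P"
  by (cases hh) (auto simp: mixed_primes_def dest: mixed_coincidencesD(3,4))

lemma finite_mixed_primes: "finite (mixed_primes hh)"
  using mixed_primes_subset finite_P by (meson finite_SigmaI finite_subset)

lemma card_primes_dvd_denom_le:
  assumes "has_small_fraction h"
  shows "card {v \<in> P. int v dvd denom h} \<le> 2"
proof -
  have "card {v \<in> P. int v dvd denom h} < 3"
  proof (rule card_large_prime_divisors_less[where m = "denom h" and B = V0])
    have "denom h \<le> int (V ^ 2)" using denom_numer[OF assms] by simp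
    also have "\<dots> < int (V0 ^ 3)" using size(3) by (simp only: of_nat_less_iff)
    finally show "\<bar>denom h\<bar> < int V0 ^ 3" using denom_numer[OF assms] by simp
  qed (use denom_numer[OF assms] V0 finite_P P in auto)
  thus ?thesis by simp
qed

lemma has_small_fraction_if_two_coincidences:
  assumes v: "(((h, k), v), ((h', k'), v')) \<in> mixed_coincidences"
    and u: "(((h, l), u), ((h', l'), u')) \<in> mixed_coincidences" and neq: "(v, v') \<noteq> (u, u')"
  shows "has_small_fraction h"
proof -
  have v_le: "prime v" "prime v'" "v \<le> V" "v' \<le> V"
    using P[OF mixed_coincidencesD(3)[OF v]] P[OF mixed_coincidencesD(4)[OF v]] by auto
  have u_le: "prime u" "u \<le> V" "u' \<le> V"
    using P[OF mixed_coincidencesD(3)[OF u]] P[OF mixed_coincidencesD(4)[OF u]] by auto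
  show ?thesis
    unfolding has_small_fraction_def
    by (rule small_fraction_if_two_relations[OF v_le(1,2) u_le(1) mixed_coincidencesD(5)[OF v] neq
        v_le(3,4) u_le(2,3) mixed_coincidences_relation(2)[OF v] mixed_coincidences_relation(2)[OF u]
        mixed_coincidences_relation(1)[OF v] mixed_coincidences_relation(1)[OF u]])
qed

lemma card_mixed_primes_le: "card (mixed_primes hh) \<le> 4"
proof (cases "\<exists>x y. x \<in> mixed_primes hh \<and> y \<in> mixed_primes hh \<and> x \<noteq> y")
  case False
  hence "card (mixed_primes hh) \<le> Suc 0"
    using finite_mixed_primes by (subst card_le_Suc0_iff_eq) auto
  thus ?thesis by simp
next
  case True
  obtain h h' where hh: "hh = (h, h')" by (cases hh)
  from True obtain v v' u u' where "(v, v') \<in> mixed_primes hh" "(u, u') \<in> mixed_primes hh"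
    and neq: "(v, v') \<noteq> (u, u')"
    by fast
  then obtain k k' l l' where
    v: "(((h, k), v), ((h', k'), v')) \<in> mixed_coincidences" and
    u: "(((h, l), u), ((h', l'), u')) \<in> mixed_coincidences"
    by (auto simp: mixed_primes_def hh)
  have frac: "has_small_fraction h" "has_small_fraction h'"
    using neq has_small_fraction_if_two_coincidences[OF v u]
      has_small_fraction_if_two_coincidences[OF mixed_coincidences_swap[OF v]
        mixed_coincidences_swap[OF u]] by auto
  have "mixed_primes hh \<subseteq> {v \<in> P. int v dvd denom h'} \<times> {v \<in> P. int v dvd denom h}"
  proof (clarsimp simp: mixed_primes_def hh)
    fix v v' k k' assume mixed: "(((h, k), v), ((h', k'), v')) \<in> mixed_coincidences"
    show "v \<in> P \<and> int v dvd denom h' \<and> v' \<in> P \<and> int v' dvd denom h"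
      using mixed_coincidencesD(3,4)[OF mixed] prime_dvd_denom[OF mixed frac]
        prime_dvd_denom[OF mixed_coincidences_swap[OF mixed] frac(2,1)] by blast
  qed
  hence "card (mixed_primes hh) \<le> card ({v \<in> P. int v dvd denom h'} \<times> {v \<in> P. int v dvd denom h})"
    using finite_P by (intro card_mono) auto
  also have "\<dots> \<le> 2 * 2"
    unfolding card_cartesian_product by (intro mult_mono card_primes_dvd_denom_le frac) auto
  finally show ?thesis by simp
qed

lemma mixed_coincidences_eqI:
  assumes k: "(((h, k), v), ((h', k'), v')) \<in> mixed_coincidences"
    and l: "(((h, l), v), ((h', l'), v')) \<in> mixed_coincidences"
    and div: "k div int v = l div int v"
  shows "k = l" "k' = l'"
proof -
  note mixedD = mixed_coincidencesD[OF k]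
  have eq: "int v' * k - int v * k' = int v' * l - int v * l'"
  proof (rule cong_small_imp_eq)
    show "[int v' * k - int v * k' = int v' * l - int v * l'] (mod int p)"
      using mixed_coincidences_relation(1)[OF k] mixed_coincidences_relation(1)[OF l]
      by (meson cong_sym cong_trans)
    have "6 * (int N * int V) < int p" "0 \<le> int N * int V"
      using monomial_less_p[OF mixedD(3), of 1 1] by simp_all
    thus "\<bar>(int v' * k - int v * k') - (int v' * l - int v * l')\<bar> < int p"
      using mixed_coincidences_relation(2)[OF k] mixed_coincidences_relation(2)[OF l] by linarith
  qed
  have v: "prime (int v)" "\<not> int v dvd int v'"
    using P[OF mixedD(3)] P[OF mixedD(4)] mixedD(5) by (auto dest: primes_dvd_imp_eq)
  have "int v' * (k - l) = int v * (k' - l')" using eq by (simp add: algebra_simps)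
  hence "int v dvd int v' * (k - l)" by simp
  hence "int v dvd k - l" using v by (simp add: prime_dvd_mult_iff)
  hence "k mod int v = l mod int v" by (simp add: mod_eq_dvd_iff)
  thus "k = l" using div by (metis div_mult_mod_eq)
  thus "k' = l'" using eq v(1) by auto
qed

lemma div_prime_bounds:
  assumes "(h, k) \<in> I" "v \<in> P"
  shows "k div int v \<in> {0..int (N div V0)}"
proof -
  have "k div int v \<le> int N div int v"
    using I_bounds[OF assms(1)] P[OF assms(2)] prime_gt_0_nat by (intro zdiv_mono1) auto
  also have "\<dots> \<le> int N div int V0" using P[OF assms(2)] V0 by (intro zdiv_mono2) auto
  also have "\<dots> = int (N div V0)" by (simp add: zdiv_int)
  finally show ?thesis
    using I_bounds[OF assms(1)] by (simp add: pos_imp_zdiv_nonneg_iff div_int_pos_iff)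
qed

lemma card_mixed_coincidences_le: "card mixed_coincidences \<le> 4 * N ^ 2 * (N div V0 + 1)"
proof -
  define H where "H = {1..int N} \<times> {1..int N}"
  define M where "M = (SIGMA hh:H. mixed_primes hh \<times> {0..int (N div V0)})"
  define code :: "((int \<times> int) \<times> nat) \<times> ((int \<times> int) \<times> nat) \<Rightarrow> (int \<times> int) \<times> (nat \<times> nat) \<times> int"
    where "code = (\<lambda>(((h, k), v), ((h', k'), v')). ((h, h'), (v, v'), k div int v))"
  have "card mixed_coincidences \<le> card M"
  proof (rule card_inj_on_le)
    show "inj_on code mixed_coincidences"
      by (rule inj_onI) (auto simp: code_def dest: mixed_coincidences_eqI)
    show "code ` mixed_coincidences \<subseteq> M"
    proof (rule image_subsetI)
      fix a assume a: "a \<in> mixed_coincidences"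
      obtain h k v h' k' v' where a_eq: "a = (((h, k), v), ((h', k'), v'))" by (metis surj_pair)
      note mixedD = mixed_coincidencesD[OF a[unfolded a_eq]]
      have "(h, h') \<in> H" using I_bounds[OF mixedD(1)] I_bounds[OF mixedD(2)] by (simp add: H_def)
      moreover have "(v, v') \<in> mixed_primes (h, h')" using a by (auto simp: mixed_primes_def a_eq)
      ultimately show "code a \<in> M"
        using div_prime_bounds[OF mixedD(1,3)] by (simp add: code_def M_def a_eq)
    qed
    show "finite M" unfolding M_def H_def using finite_mixed_primes by (intro finite_SigmaI) auto
  qed
  also have "\<dots> \<le> card H * (4 * (N div V0 + 1))"
    unfolding M_def
  proof (rule card_Sigma_le)
    fix hh
    have "card {0..int (N div V0)} = N div V0 + 1" by simp
    thus "card (mixed_primes hh \<times> {0..int (N div V0)}) \<le> 4 * (N div V0 + 1)"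
      by (simp only: card_cartesian_product mult_le_mono1 card_mixed_primes_le)
  qed (auto simp: H_def finite_mixed_primes)
  also have "\<dots> = 4 * N ^ 2 * (N div V0 + 1)"
    by (simp add: H_def card_cartesian_product power2_eq_square algebra_simps)
  finally show ?thesis .
qed

lemma coincidences_same_prime:
  assumes "((x, v), (y, v)) \<in> coincidences"
  shows "x = y"
proof -
  have mem: "x \<in> I" "y \<in> I" "v \<in> P" and "[int v * offset x = int v * offset y] (mod int p)"
    using assms by (auto simp: coincidences_def admissible_def)
  hence "[offset x = offset y] (mod int p)"
    using coprime_P[OF mem(3)] by (simp only: cong_mult_lcancel)
  thus "x = y" using inj_onD[OF I(2), of x y] mem by (simp add: cong_def)
qed

lemma finite_coincidences: "finite coincidences"
  by (rule finite_subset[of _ "admissible \<times> admissible"])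
    (auto simp: coincidences_def finite_admissible)

lemma card_coincidences_le: "card coincidences \<le> card admissible + 4 * N ^ 2 * (N div V0 + 1)"
proof -
  have "coincidences \<subseteq> (\<lambda>a. (a, a)) ` admissible \<union> mixed_coincidences"
  proof clarsimp
    fix h k v h' k' v'
    assume coincidence: "(((h, k), v), ((h', k'), v')) \<in> coincidences"
      and "(((h, k), v), ((h', k'), v')) \<notin> mixed_coincidences"
    hence "v = v'" by (simp add: mixed_coincidences_def)
    moreover from this have "(h, k) = (h', k')" using coincidence coincidences_same_prime by blast
    ultimately show "(((h, k), v), ((h', k'), v')) \<in> (\<lambda>a. (a, a)) ` admissible"
      using coincidence by (simp add: coincidences_def)
  qed
  moreover have "finite mixed_coincidences"
    using finite_coincidences by (rule rev_finite_subset) (auto simp: mixed_coincidences_def)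
  ultimately have "card coincidences \<le> card ((\<lambda>a. (a, a)) ` admissible \<union> mixed_coincidences)"
    using finite_admissible by (intro card_mono) auto
  also have "\<dots> \<le> card ((\<lambda>a. (a, a)) ` admissible) + card mixed_coincidences" by (rule card_Un_le)
  also have "\<dots> \<le> card admissible + 4 * N ^ 2 * (N div V0 + 1)"
    by (intro add_mono card_image_le finite_admissible card_mixed_coincidences_le)
  finally show ?thesis .
qed

definition quotient :: "(int \<times> int) \<times> nat \<Rightarrow> int" where
  "quotient a = (SOME x. x \<in> {0..<int p} \<and> [int (snd a) * x = offset (fst a)] (mod int p))"

lemma quotient:
  assumes "a \<in> admissible"
  shows "quotient a \<in> {0..<int p}" "[int (snd a) * quotient a = offset (fst a)] (mod int p)"
proof -
  have "coprime (int (snd a)) (int p)" using assms by (intro coprime_P) (auto simp: admissible_def)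
  hence "\<exists>x\<in>{0..<int p}. [int (snd a) * x = offset (fst a)] (mod int p)"
    by (rule exists_residue_mult_cong) (simp add: prime_gt_0_nat p)
  from someI_ex[OF this[unfolded Bex_def]] show "quotient a \<in> {0..<int p}"
    "[int (snd a) * quotient a = offset (fst a)] (mod int p)" by (simp_all only: quotient_def)
qed

lemma quotient_eq_imp_coincidence:
  assumes "a \<in> admissible" "b \<in> admissible" "quotient a = quotient b"
  shows "(a, b) \<in> coincidences"
proof -
  have "[int (snd b) * offset (fst a) = int (snd b) * (int (snd a) * quotient a)] (mod int p)"
    by (intro cong_mult cong_refl cong_sym[OF quotient(2)] assms)
  also have "int (snd b) * (int (snd a) * quotient a) = int (snd a) * (int (snd b) * quotient b)"
    by (simp add: assms(3))
  also have "[\<dots> = int (snd a) * offset (fst b)] (mod int p)"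
    by (intro cong_mult cong_refl quotient(2) assms)
  finally show ?thesis using assms by (simp add: coincidences_def)
qed

lemma exists_many_quotients:
  "\<exists>X \<subseteq> {0..<int p}. (\<forall>x\<in>X. \<exists>y\<in>I. \<exists>v\<in>P. [int v * x = offset y] (mod int p)) \<and>
     (card I * (card P - 4))\<^sup>2 \<le> card X * (card I * card P + 4 * N ^ 2 * (N div V0 + 1))"
proof (intro exI conjI)
  let ?X = "quotient ` admissible"
  show "?X \<subseteq> {0..<int p}" using quotient(1) by blast
  show "\<forall>x\<in>?X. \<exists>y\<in>I. \<exists>v\<in>P. [int v * x = offset y] (mod int p)"
  proof
    fix x assume "x \<in> ?X"
    then obtain y v where "(y, v) \<in> admissible" "x = quotient (y, v)" by auto
    thus "\<exists>y\<in>I. \<exists>v\<in>P. [int v * x = offset y] (mod int p)"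
      using quotient(2)[of "(y, v)"] by (auto simp: admissible_def)
  qed
  have "card {(a, b) \<in> admissible \<times> admissible. quotient a = quotient b} \<le> card coincidences"
    using quotient_eq_imp_coincidence by (intro card_mono finite_coincidences) blast
  also have "\<dots> \<le> card I * card P + 4 * N ^ 2 * (N div V0 + 1)"
    using card_coincidences_le card_admissible_le by linarith
  finally have energy: "card {(a, b) \<in> admissible \<times> admissible. quotient a = quotient b} \<le>
      card I * card P + 4 * N ^ 2 * (N div V0 + 1)" .
  have "(card I * (card P - 4))\<^sup>2 \<le> (card admissible)\<^sup>2"
    by (intro power_mono card_admissible_ge) auto
  also have "\<dots> \<le> card ?X * card {(a, b) \<in> admissible \<times> admissible. quotient a = quotient b}"
    by (rule card_square_le_card_image_mult_energy[OF finite_admissible])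
  also have "\<dots> \<le> card ?X * (card I * card P + 4 * N ^ 2 * (N div V0 + 1))"
    using energy by (rule mult_le_mono2)
  finally show "(card I * (card P - 4))\<^sup>2 \<le> card ?X * (card I * card P + 4 * N ^ 2 * (N div V0 + 1))" .
qed

end

subsection \<open>Points of the cubic in a box\<close>

definition has_two_point_box :: "int \<Rightarrow> int \<Rightarrow> int \<Rightarrow> int \<Rightarrow> bool" where
  "has_two_point_box p a c H \<longleftrightarrow> (\<exists>X Y. 0 \<le> X \<and> X \<le> p - 1 \<and> 0 \<le> Y \<and> Y \<le> p - 1 \<and>
    2 \<le> card (curve_pts p a c \<inter> box_pts p X Y H))"

lemma finite_curve_pts: "finite (curve_pts p a c)"
  by (rule finite_subset[of _ "{0..p - 1} \<times> {0..p - 1}"]) (auto simp: curve_pts_def)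

lemma cubic_cong:
  fixes x y :: int
  assumes "[x = y] (mod p)"
  shows "[a * x ^ 3 + c * x = a * y ^ 3 + c * y] (mod p)"
  by (intro cong_add cong_mult cong_pow cong_refl assms)

lemma mem_curve_Int_box:
  assumes "p > 0" and "1 \<le> i" "i \<le> H" "1 \<le> j" "j \<le> H"
    and "[x = X + i] (mod p)" "[a * x ^ 3 + c * x = Y + j] (mod p)"
  shows "(x mod p, (a * x ^ 3 + c * x) mod p) \<in> curve_pts p a c \<inter> box_pts p X Y H"
proof -
  have "[(a * x ^ 3 + c * x) mod p = a * (x mod p) ^ 3 + c * (x mod p)] (mod p)"
    using cubic_cong[of x "x mod p" p a c] by (simp add: cong_def)
  moreover have "0 \<le> z mod p" "z mod p \<le> p - 1" for z using assms(1) by auto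
  ultimately show ?thesis using assms(2-) by (auto simp: curve_pts_def box_pts_def cong_def)
qed

lemma has_two_point_box_if_cong:
  assumes p: "p > 1" and h: "1 \<le> h" "h < H" "h < p" and k: "0 \<le> k" "k < H"
    and eq: "[(a * (x + h) ^ 3 + c * (x + h)) - (a * x ^ 3 + c * x) = k] (mod p)"
  shows "has_two_point_box p a c H"
proof -
  let ?f = "\<lambda>x. a * x ^ 3 + c * x"
  let ?X = "(x - 1) mod p" and ?Y = "(?f x - 1) mod p"
  let ?S = "curve_pts p a c \<inter> box_pts p ?X ?Y H"
  have first: "(x mod p, ?f x mod p) \<in> ?S"
    using p h k by (intro mem_curve_Int_box[of p 1 H 1]) (auto simp: cong_def mod_simps)
  have "[?f x + (?f (x + h) - ?f x) = ?f x + k] (mod p)" using eq by (intro cong_add cong_refl)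
  hence "[?f (x + h) = (?f x - 1) + (k + 1)] (mod p)" by (simp add: add.assoc)
  hence second: "((x + h) mod p, ?f (x + h) mod p) \<in> ?S"
    using p h k by (intro mem_curve_Int_box[of p "h + 1" H "k + 1"]) (auto simp: cong_def mod_simps)
  have "\<not> p dvd (x + h) - x" using h by (simp add: zdvd_not_zless)
  hence "x mod p \<noteq> (x + h) mod p" by (metis mod_eq_dvd_iff)
  hence "card {(x mod p, ?f x mod p), ((x + h) mod p, ?f (x + h) mod p)} = 2" by simp
  moreover have "card {(x mod p, ?f x mod p), ((x + h) mod p, ?f (x + h) mod p)} \<le> card ?S"
    using first second by (intro card_mono finite_Int disjI1 finite_curve_pts) blast
  ultimately show ?thesis
    using p unfolding has_two_point_box_def by (intro exI[of _ ?X] exI[of _ ?Y]) auto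
qed

lemma has_two_point_box_if_side_ge:
  assumes "p > 1" "H \<ge> p"
  shows "has_two_point_box p a c H"
proof (rule has_two_point_box_if_cong)
  show "[(a * (0 + 1) ^ 3 + c * (0 + 1)) - (a * 0 ^ 3 + c * 0) = (a + c) mod p] (mod p)"
    by (simp add: cong_def)
  show "(a + c) mod p < H" using assms pos_mod_bound[of p "a + c"] by linarith
qed (use assms in auto)

lemma cubic_difference_discriminant:
  fixes a c h k x :: int
  shows "(6 * a * h * x + 3 * a * h ^ 2) ^ 2 - 12 * a * h * (k - (A * h ^ 3 + c * h)) =
    12 * a * h * ((a * (x + h) ^ 3 + c * (x + h)) - (a * x ^ 3 + c * x) - k) +
    3 * a * h ^ 4 * (4 * A - a)"
  by (simp add: algebra_simps eval_nat_numeral)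

lemma has_two_point_box_if_square:
  fixes p a c h k y A H :: int
  assumes p: "prime p" "p > 3" and a: "\<not> p dvd a" and A: "[4 * A = a] (mod p)"
    and h: "1 \<le> h" "h < H" "h < p" and k: "0 \<le> k" "k < H"
    and y: "[y ^ 2 = 12 * a * h * (k - (A * h ^ 3 + c * h))] (mod p)"
  shows "has_two_point_box p a c H"
proof -
  have not_dvd: "\<not> p dvd 2" "\<not> p dvd 3" "\<not> p dvd h" using p(2) h zdvd_not_zless by auto
  have six: "6 * a * h = 2 * 3 * a * h" and twelve: "12 * a * h = 2 * 2 * 3 * a * h" by simp_all
  have "\<not> p dvd 6 * a * h"
    unfolding six using not_dvd a p(1) by (simp only: prime_dvd_mult_iff) simp
  hence "coprime (6 * a * h) p" using p(1) prime_imp_coprime coprime_commute by blast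
  then obtain x where "[6 * a * h * x = y - 3 * a * h ^ 2] (mod p)"
    using exists_residue_mult_cong[of "6 * a * h" p] p(2) by force
  hence "[6 * a * h * x + 3 * a * h ^ 2 = y - 3 * a * h ^ 2 + 3 * a * h ^ 2] (mod p)"
    by (intro cong_add cong_refl)
  hence "[(6 * a * h * x + 3 * a * h ^ 2) ^ 2 = y ^ 2] (mod p)" using cong_pow by fastforce
  hence "[(6 * a * h * x + 3 * a * h ^ 2) ^ 2 = 12 * a * h * (k - (A * h ^ 3 + c * h))] (mod p)"
    using y by (rule cong_trans)
  hence "p dvd 12 * a * h * ((a * (x + h) ^ 3 + c * (x + h)) - (a * x ^ 3 + c * x) - k) +
      3 * a * h ^ 4 * (4 * A - a)"
    unfolding cong_iff_dvd_diff cubic_difference_discriminant .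
  moreover have "p dvd 3 * a * h ^ 4 * (4 * A - a)" using A by (simp add: cong_iff_dvd_diff)
  ultimately have "p dvd 12 * a * h * ((a * (x + h) ^ 3 + c * (x + h)) - (a * x ^ 3 + c * x) - k)"
    by (simp only: dvd_add_left_iff)
  hence "p dvd (a * (x + h) ^ 3 + c * (x + h)) - (a * x ^ 3 + c * x) - k"
    unfolding twelve using not_dvd a p(1) by (simp only: prime_dvd_mult_iff) simp
  hence "[(a * (x + h) ^ 3 + c * (x + h)) - (a * x ^ 3 + c * x) = k] (mod p)"
    by (simp only: cong_iff_dvd_diff)
  thus ?thesis using p(2) h k by (intro has_two_point_box_if_cong[of p h H k]) auto
qed

lemma exists_four_times_cong:
  assumes "prime p" "p > 3"
  shows "\<exists>A. [4 * A = a] (mod int p)"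
proof -
  have "\<not> int p dvd 2" using assms(2) by (intro zdvd_not_zless) auto
  hence "\<not> int p dvd 2 * 2"
    using assms(1) by (simp only: prime_dvd_mult_iff prime_nat_int_transfer) simp
  hence "coprime 4 (int p)"
    using assms(1) prime_imp_coprime[of "int p" 4] by (simp add: coprime_commute)
  thus ?thesis using exists_residue_mult_cong[of 4 "int p" a] assms(2) by auto
qed

locale sparse_cubic = cubic_mod +
  fixes a H :: int
  assumes p_gt_3: "p > 3" and four_A: "[4 * A = a] (mod int p)"
    and N_le: "2 * int N \<le> H" and sparse: "\<not> has_two_point_box (int p) a c H"
begin

lemma not_p_dvd_a: "\<not> int p dvd a"
proof -
  have "\<not> int p dvd 2" using p_gt_3 by (intro zdvd_not_zless) auto
  hence "\<not> int p dvd 2 * 2 * A"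
    using A p by (simp only: prime_dvd_mult_iff prime_nat_int_transfer) simp
  thus ?thesis using cong_dvd_iff[OF four_A] by simp
qed

lemma Legendre_offset:
  assumes "1 \<le> h" "h \<le> int N" "0 \<le> k" "k < 2 * int N"
  shows "Legendre (12 * a * h) (int p) * Legendre (k - F h) (int p) = -1"
proof -
  let ?D = "12 * a * h * (k - F h)"
  have not_square: "\<not> [y ^ 2 = ?D] (mod int p)" for y
    using has_two_point_box_if_square[of "int p" a A h H k y c] p p_gt_3 not_p_dvd_a four_A assms N_le
      N_less_p sparse unfolding F_def by auto
  have "\<not> QuadRes (int p) ?D" using not_square by (simp add: QuadRes_def)
  moreover have "\<not> [?D = 0] (mod int p)" using not_square[of 0] by (auto simp: cong_sym_eq)
  ultimately have "Legendre ?D (int p) = -1" by (simp add: Legendre_def)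
  thus ?thesis using p p_gt_3 by (simp add: Legendre_mult)
qed

lemma not_p_dvd_offset:
  assumes "x \<in> grid"
  shows "\<not> int p dvd offset x"
proof -
  have "Legendre (offset x) (int p) \<noteq> 0"
    using Legendre_offset[of "fst x" "snd x"] assms by (auto simp: grid_def offset_def)
  thus ?thesis by (simp add: Legendre_eq_0_iff)
qed

lemma quotient_in_Legendre_runs:
  assumes x: "x \<in> {0..<int p}" "[int v * x = offset (h, j)] (mod int p)" and hj: "(h, j) \<in> grid"
    and k: "k \<ge> 1" "v * k \<le> N"
  shows "x \<in> Legendre_runs p k 1 \<union> Legendre_runs p k (-1)"
proof -
  define \<eta> where "\<eta> = - Legendre (12 * a * h) (int p) * Legendre (int v) (int p)"
  have run: "Legendre (x + int w) (int p) = \<eta> \<and> \<eta> \<in> {1, -1}" if w: "w \<in> {1..k}" for w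
  proof -
    have "v * w \<le> N" using w k(2) by (meson atLeastAtMost_iff le_trans mult_le_mono2)
    hence "int (v * w) \<le> int N" by (simp only: of_nat_le_iff)
    hence bounds: "1 \<le> h" "h \<le> int N" "0 \<le> j + int v * int w" "j + int v * int w < 2 * int N"
      using hj by (auto simp: grid_def)
    have "[int v * x + int v * int w = offset (h, j) + int v * int w] (mod int p)"
      using x(2) by (intro cong_add cong_refl)
    hence "[int v * (x + int w) = j + int v * int w - F h] (mod int p)"
      by (simp add: offset_def algebra_simps)
    hence "Legendre (int v) (int p) * Legendre (x + int w) (int p) =
        Legendre (j + int v * int w - F h) (int p)"
      using Legendre_cong Legendre_mult[OF p, of "int v" "x + int w"] p_gt_3 by simp
    hence "Legendre (12 * a * h) (int p) *
        (Legendre (int v) (int p) * Legendre (x + int w) (int p)) = -1"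
      using Legendre_offset[OF bounds] by simp
    thus ?thesis
      using Legendre_range[of "12 * a * h" "int p"] Legendre_range[of "int v" "int p"]
        Legendre_range[of "x + int w" "int p"] by (auto simp: \<eta>_def)
  qed
  have "x \<in> Legendre_runs p k \<eta>" using run x(1) by (auto simp: Legendre_runs_def)
  moreover have "\<eta> \<in> {1, -1}" using run[of 1] k(1) by auto
  ultimately show ?thesis by auto
qed

lemma card_quotients_le:
  assumes X: "X \<subseteq> {0..<int p}" "\<And>x. x \<in> X \<Longrightarrow> \<exists>y\<in>grid. \<exists>v\<in>P. [int v * x = offset y] (mod int p)"
    and k: "1 \<le> k" "k < p" "\<And>v. v \<in> P \<Longrightarrow> v * k \<le> N"
  shows "card X \<le> 2 * (p / 2 ^ k + 27 * real k * sqrt p)"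
proof -
  have "X \<subseteq> Legendre_runs p k 1 \<union> Legendre_runs p k (-1)"
  proof
    fix x assume "x \<in> X"
    with X obtain h j v where "x \<in> {0..<int p}" "(h, j) \<in> grid" "v \<in> P"
      "[int v * x = offset (h, j)] (mod int p)" by fast
    thus "x \<in> Legendre_runs p k 1 \<union> Legendre_runs p k (-1)"
      using k by (intro quotient_in_Legendre_runs)
  qed
  moreover have "finite (Legendre_runs p k \<eta>)" for \<eta>
    by (rule finite_subset[of _ "{0..<int p}"]) (auto simp: Legendre_runs_def)
  ultimately have "card X \<le> card (Legendre_runs p k 1 \<union> Legendre_runs p k (-1))"
    by (intro card_mono) auto
  also have "\<dots> \<le> card (Legendre_runs p k 1) + card (Legendre_runs p k (-1))" by (rule card_Un_le)
  finally have "real (card X) \<le> card (Legendre_runs p k 1) + card (Legendre_runs p k (-1))"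
    by linarith
  also have "\<dots> \<le> (p / 2 ^ k + 27 * real k * sqrt p) + (p / 2 ^ k + 27 * real k * sqrt p)"
    using p p_gt_3 k unfolding of_nat_add by (intro add_mono card_Legendre_runs_le) auto
  finally show ?thesis by simp
qed

end

lemma quotient_count_arith:
  fixes i m n q t x :: nat
  assumes i: "n \<le> i * t" and x: "(i * (m - 4))\<^sup>2 \<le> x * (i * m + 4 * n * q)"
    and m: "8 \<le> m" "4 * q * t \<le> m" and "n > 0"
  shows "n * m \<le> 8 * x * t"
proof -
  have "4 * n * q \<le> i * (4 * q * t)" using mult_le_mono1[OF i, of "4 * q"] by (simp add: mult_ac)
  also have "\<dots> \<le> i * m" using m(2) by (rule mult_le_mono2)
  finally have square: "(i * (m - 4))\<^sup>2 \<le> x * (i * m + i * m)"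
    using x by (meson add_left_mono le_trans mult_le_mono2)
  have "m \<le> 2 * (m - 4)" using m(1) by linarith
  from mult_le_mono2[OF this, of i] have "i * m \<le> 2 * (i * (m - 4))" by (simp add: mult_ac)
  hence "(i * m)\<^sup>2 \<le> (2 * (i * (m - 4)))\<^sup>2" by (intro power_mono) auto
  also have "\<dots> = 4 * (i * (m - 4))\<^sup>2" by (simp only: power_mult_distrib) simp
  also have "\<dots> \<le> 4 * (x * (i * m + i * m))" using square by (rule mult_le_mono2)
  finally have "(i * m) * (i * m) \<le> (i * m) * (8 * x)" by (simp add: power2_eq_square mult_ac)
  moreover have "i * m > 0" using i m(1) \<open>n > 0\<close> by (auto intro!: Nat.gr0I)
  ultimately have im: "i * m \<le> 8 * x" by (simp only: nat_mult_le_cancel_disj)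
  have "n * m \<le> i * t * m" using i by (rule mult_le_mono1)
  also have "\<dots> = i * m * t" by simp
  also have "\<dots> \<le> 8 * x * t" using im by (rule mult_le_mono1)
  finally show ?thesis .
qed

context sparse_cubic
begin

lemma card_primes_mult_square_le:
  assumes P: "\<And>v. v \<in> P \<Longrightarrow> prime v \<and> V0 \<le> v \<and> v \<le> V"
    and V: "0 < V0" "6 * N * V ^ 5 < p" "3 * N * V ^ 2 < V0 ^ 5" "V ^ 2 < V0 ^ 3" "V * k \<le> N"
    and k: "1 \<le> k" "k < p" and many: "8 \<le> card P" "4 * (N div V0 + 1) * (3 + 4 * T) \<le> card P"
  shows "real (N ^ 2 * card P) \<le> 16 * (p / 2 ^ k + 27 * real k * sqrt p) * real (3 + 4 * T)"
proof -
  obtain I where I_grid: "I \<subseteq> grid" and I_inj: "inj_on (\<lambda>x. offset x mod int p) I"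
    and card_I: "N ^ 2 \<le> card I * (3 + 4 * T)"
    using exists_many_distinct_offsets by blast
  interpret cubic_quotients p A c N T I P V0 V
    by unfold_locales (use I_grid I_inj P V not_p_dvd_offset in auto)
  obtain X where X: "X \<subseteq> {0..<int p}" "\<And>x. x \<in> X \<Longrightarrow> \<exists>y\<in>I. \<exists>v\<in>P. [int v * x = offset y] (mod int p)"
      "(card I * (card P - 4))\<^sup>2 \<le> card X * (card I * card P + 4 * N ^ 2 * (N div V0 + 1))"
    using exists_many_quotients by blast
  have "v * k \<le> N" if "v \<in> P" for v
    using P[OF that] V(5) by (meson le_trans mult_le_mono1)
  hence card_X: "card X \<le> 2 * (p / 2 ^ k + 27 * real k * sqrt p)"
    using X(2) I_grid k by (intro card_quotients_le[OF X(1)]) blast+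
  have "N ^ 2 * card P \<le> 8 * card X * (3 + 4 * T)"
    using N(1) by (intro quotient_count_arith[OF card_I X(3) many]) simp
  hence "real (N ^ 2 * card P) \<le> real (8 * card X * (3 + 4 * T))" by (simp only: of_nat_le_iff)
  also have "\<dots> = 8 * real (card X) * real (3 + 4 * T)" by simp
  also have "\<dots> \<le> 8 * (2 * (p / 2 ^ k + 27 * real k * sqrt p)) * real (3 + 4 * T)"
    using card_X by (intro mult_right_mono mult_left_mono) auto
  finally show ?thesis by simp
qed

end

subsection \<open>Choice of the parameters\<close>

lemma eventually_many_primes_between:
  fixes \<alpha> \<beta> \<gamma> :: real
  assumes "0 < \<alpha>" "\<alpha> < \<gamma>" "\<gamma> < \<beta>"
  shows "\<forall>\<^sub>F n::nat in sequentially. real n powr \<gamma> \<le>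
    card {q::nat. prime q \<and> nat \<lceil>real n powr \<alpha>\<rceil> \<le> q \<and> q \<le> nat \<lfloor>real n powr \<beta>\<rfloor>}"
proof -
  let ?z = "\<lambda>n. real n powr \<beta>" and ?w = "\<lambda>n. real (nat \<lceil>real n powr \<alpha>\<rceil>)"
  have "\<forall>\<^sub>F n in sequentially. real n powr \<gamma> \<le> ?z n / (8 * ln (?z n)) - ?w n"
    using assms by real_asymp
  moreover have "\<forall>\<^sub>F n in sequentially. ?z n \<ge> 4" using assms by real_asymp
  ultimately show ?thesis
  proof eventually_elim
    case (elim n)
    define V0 where "V0 = nat \<lceil>real n powr \<alpha>\<rceil>"
    define V where "V = nat \<lfloor>real n powr \<beta>\<rfloor>"
    let ?P = "{q. prime q \<and> V0 \<le> q \<and> q \<le> V}"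
    have "{q::nat. prime q \<and> q \<le> ?z n} \<subseteq> ?P \<union> {..<V0}"
      by (auto simp: V_def le_nat_floor)
    hence "card {q::nat. prime q \<and> q \<le> ?z n} \<le> card (?P \<union> {..<V0})"
      by (rule card_mono[rotated]) simp
    also have "\<dots> \<le> card ?P + V0" using card_Un_le[of ?P "{..<V0}"] by simp
    finally have "card {q::nat. prime q \<and> q \<le> ?z n} \<le> card ?P + V0" .
    moreover have "?z n / (8 * ln (?z n)) \<le> card {q::nat. prime q \<and> q \<le> ?z n}"
      using elim(2) by (rule card_primes_ge)
    ultimately show ?case using elim(1) unfolding V0_def V_def by linarith
  qed
qed

lemma has_two_point_box_if_many_primes:
  fixes p N V0 V k :: nat and D M :: real
  assumes p: "prime p" "p > 3" "\<not> int p dvd a"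
    and N_bounds: "N > 0" "2 * int N \<le> H" "18 * N ^ 5 < p"
    and D: "\<And>m::nat. 0 < m \<Longrightarrow> m < p \<Longrightarrow> card {d. d dvd m} \<le> D"
    and P: "\<And>v. v \<in> P \<Longrightarrow> prime v \<and> V0 \<le> v \<and> v \<le> V"
    and V: "0 < V0" "6 * N * V ^ 5 < p" "3 * N * V ^ 2 < V0 ^ 5" "V ^ 2 < V0 ^ 3" "V * k \<le> N"
    and k: "1 \<le> k" "k < p" "log 2 p \<le> k"
    and M: "M \<le> card P" "8 \<le> M" "4 * (N / V0 + 1) * (3 + 4 * D) \<le> M"
      "16 * (1 + 27 * real k * sqrt p) * (3 + 4 * D) < real N ^ 2 * M"
  shows "has_two_point_box (int p) a c H"
proof (rule ccontr)
  assume sparse: "\<not> has_two_point_box (int p) a c H"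
  obtain A where A: "[4 * A = a] (mod int p)" using exists_four_times_cong[OF p(1,2)] by blast
  have "\<not> int p dvd A" using cong_dvd_iff[OF A] p(3) by auto
  define T where "T = nat \<lfloor>D\<rfloor>"
  have "card {d. d dvd m} \<le> T" if "0 < m" "m \<le> 3 * N ^ 5" for m :: nat
    unfolding T_def using D[OF that(1)] that(2) N_bounds(3) by (intro le_nat_floor) simp
  with \<open>\<not> int p dvd A\<close> interpret sparse_cubic p A c N T a H
    using p N_bounds A sparse by unfold_locales
  have "real (card {d::nat. d dvd 1}) \<le> D" using p_gt_3 by (intro D) auto
  hence T_le: "real (3 + 4 * T) \<le> 3 + 4 * D" by (simp add: T_def of_nat_floor)
  have "real (4 * (N div V0 + 1) * (3 + 4 * T)) \<le> 4 * (N / V0 + 1) * (3 + 4 * D)"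
    unfolding of_nat_mult by (intro mult_mono T_le) (simp_all add: of_nat_div_le_of_nat)
  hence "real (4 * (N div V0 + 1) * (3 + 4 * T)) \<le> real (card P)" using M(1,3) by linarith
  hence "4 * (N div V0 + 1) * (3 + 4 * T) \<le> card P" by (simp only: of_nat_le_iff)
  moreover have "8 \<le> card P" using M(1,2) by linarith
  ultimately have "real (N ^ 2 * card P) \<le> 16 * (p / 2 ^ k + 27 * real k * sqrt p) * real (3 + 4 * T)"
    using P V k(1,2) by (intro card_primes_mult_square_le)
  also have "\<dots> \<le> 16 * (1 + 27 * real k * sqrt p) * (3 + 4 * D)"
  proof (intro mult_mono T_le mult_left_mono add_right_mono)
    have "real p = 2 powr (log 2 p)" using p_gt_3 by simp
    also have "\<dots> \<le> 2 powr k" using k(3) by (rule powr_mono) simp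
    finally show "p / 2 ^ k \<le> 1" by (simp add: powr_realpow)
  qed simp_all
  also have "\<dots> < real N ^ 2 * M" by (rule M(4))
  also have "\<dots> \<le> real (N ^ 2 * card P)" using M(1) by (simp add: mult_left_mono)
  finally show False by simp
qed

lemma eventually_has_two_point_box:
  fixes e :: real
  assumes e: "0 < e" "e \<le> 1 / 100"
  shows "\<forall>\<^sub>F p::nat in sequentially. \<forall>a c H. prime p \<longrightarrow> \<not> int p dvd a \<longrightarrow>
    2 * real p powr (1/6 + e) \<le> real_of_int H \<longrightarrow> has_two_point_box (int p) a c H"
proof -
  obtain C where "C > 0" and divisors:
      "\<And>m n::nat. 0 < m \<Longrightarrow> m \<le> n \<Longrightarrow> card {d. d dvd m} \<le> C * real n powr (e/8)"
    using divisor_bound_mono[of "e/8"] e by auto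
  define N where "N = (\<lambda>p::nat. nat \<lfloor>real p powr (1/6 + e)\<rfloor>)"
  define V where "V = (\<lambda>p::nat. nat \<lfloor>real p powr (1/6 - e/2)\<rfloor>)"
  define V0 where "V0 = (\<lambda>p::nat. nat \<lceil>real p powr (1/6 - e)\<rceil>)"
  define P where "P = (\<lambda>p. {q. prime q \<and> V0 p \<le> q \<and> q \<le> V p})"
  define k where "k = (\<lambda>p::nat. nat \<lceil>log 2 (real p)\<rceil>)"
  define D where "D = (\<lambda>p::nat. C * real p powr (e/8))"
  have "\<forall>\<^sub>F p in sequentially. real p powr (1/6 - 3*e/4) \<le> card (P p)"
    unfolding P_def V0_def V_def using e by (intro eventually_many_primes_between) auto
  moreover have "\<forall>\<^sub>F p in sequentially. p > 3 \<and> N p > 0 \<and> 18 * N p ^ 5 < p \<and> 0 < V0 p \<and>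
      6 * N p * V p ^ 5 < p \<and> 3 * N p * V p ^ 2 < V0 p ^ 5 \<and> V p ^ 2 < V0 p ^ 3 \<and>
      V p * k p \<le> N p \<and> 1 \<le> k p \<and> k p < p"
    unfolding N_def V_def V0_def k_def using e by (intro eventually_conj; real_asymp)
  moreover have "\<forall>\<^sub>F p in sequentially. 8 \<le> real p powr (1/6 - 3*e/4) \<and>
      4 * (N p / V0 p + 1) * (3 + 4 * D p) \<le> real p powr (1/6 - 3*e/4) \<and>
      16 * (1 + 27 * real (k p) * sqrt p) * (3 + 4 * D p) < real (N p) ^ 2 * real p powr (1/6 - 3*e/4)"
    unfolding N_def V0_def k_def D_def using e \<open>C > 0\<close> by (intro eventually_conj; real_asymp)
  ultimately show ?thesis
  proof eventually_elim
    case (elim p)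
    show ?case
    proof (intro allI impI)
      fix a c H
      assume p: "prime p" "\<not> int p dvd a" and "2 * real p powr (1/6 + e) \<le> real_of_int H"
      moreover have "real (N p) \<le> real p powr (1/6 + e)" unfolding N_def by (rule of_nat_floor) simp
      ultimately have "2 * int (N p) \<le> H" by linarith
      thus "has_two_point_box (int p) a c H"
        using elim p divisors[of _ p]
        by (intro has_two_point_box_if_many_primes[of p a "N p" H "D p" "P p" "V0 p" "V p" "k p"
              "real p powr (1/6 - 3*e/4)"]) (auto simp: P_def k_def D_def)
    qed
  qed
qed

lemma exists_constant_has_two_point_box:
  fixes \<epsilon> :: real
  assumes "\<epsilon> > 0"
  shows "\<exists>C>0. \<forall>p a c H. prime p \<longrightarrow> p > 3 \<longrightarrow> \<not> p dvd a \<longrightarrow>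
    C * real_of_int p powr (1/6 + \<epsilon>) \<le> real_of_int H \<longrightarrow> has_two_point_box p a c H"
proof -
  define e where "e = min \<epsilon> (1 / 100)"
  have e: "0 < e" "e \<le> 1 / 100" "e \<le> \<epsilon>" using assms by (auto simp: e_def)
  obtain p0 where large: "\<And>p a c H. p0 \<le> p \<Longrightarrow> prime p \<Longrightarrow> \<not> int p dvd a \<Longrightarrow>
      2 * real p powr (1/6 + e) \<le> real_of_int H \<Longrightarrow> has_two_point_box (int p) a c H"
    using eventually_has_two_point_box[OF e(1,2)] unfolding eventually_sequentially by blast
  have "has_two_point_box p a c H"
    if p: "prime p" "p > 3" and a: "\<not> p dvd a"
      and H: "(2 + real p0) * real_of_int p powr (1/6 + \<epsilon>) \<le> real_of_int H" for p a c H :: int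
  proof (cases "nat p \<ge> p0")
    case True
    have "2 * real (nat p) powr (1/6 + e) \<le> (2 + real p0) * real_of_int p powr (1/6 + \<epsilon>)"
      using p e by (intro mult_mono powr_mono) auto
    thus ?thesis using large[of "nat p" a H c] True p a H by simp
  next
    case False
    hence "real_of_int p \<le> (2 + real p0) * 1" by simp
    also have "\<dots> \<le> (2 + real p0) * real_of_int p powr (1/6 + \<epsilon>)"
      using p assms by (intro mult_left_mono ge_one_powr_ge_zero) auto
    also note H
    finally show ?thesis using p(2) by (intro has_two_point_box_if_side_ge) simp_all
  qed
  thus ?thesis by (intro exI[of _ "2 + real p0"]) auto
qed

theorem theorem2:
  "\<forall>\<epsilon>::real. \<epsilon> > 0 \<longrightarrow> (\<exists>C::real. C > 0 \<and>
     (\<forall>(p::int) (a::int) (c::int) (H::int).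
        prime p \<longrightarrow> p > 3 \<longrightarrow> gcd a p = 1 \<longrightarrow> H > 0 \<longrightarrow>
        real_of_int H \<ge> C * (real_of_int p) powr (1/6 + \<epsilon>) \<longrightarrow>
        (\<exists>X Y. 0 \<le> X \<and> X \<le> p - 1 \<and> 0 \<le> Y \<and> Y \<le> p - 1 \<and>
           card (curve_pts p a c \<inter> box_pts p X Y H) \<ge> 2)))"
  unfolding has_two_point_box_def[symmetric]
proof (intro allI impI, goal_cases)
  case (1 \<epsilon>)
  then obtain C where "C > 0" and C: "\<And>p a c H. prime p \<Longrightarrow> p > 3 \<Longrightarrow> \<not> p dvd a \<Longrightarrow>
      C * real_of_int p powr (1/6 + \<epsilon>) \<le> real_of_int H \<Longrightarrow> has_two_point_box p a c H"
    using exists_constant_has_two_point_box by blast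
  have not_dvd: "\<not> p dvd a" if "prime p" "gcd a p = 1" for p a :: int
    using that by (metis dvd_refl gcd_greatest not_prime_unit)
  show ?case
    using \<open>C > 0\<close> by (intro exI[of _ C] conjI allI impI C not_dvd)
qed

end
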